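(* The model-checking problems for $\mathrm{LTL}_B(\mathbf{U})$ and for $\mathrm{LTL}_B(\mathbf{G},\lor)$ are undecidable.
   Context: A $d$-dimensional constant-rate multi-mode system (MMS) is a finite set $\mathcal{M}\subseteq\mathbb{R}^d$ ($d\ge 1$) of vectors called modes. A schedule is a finite or infinite sequence $\pi=(\alpha_1,\vec m_1)(\alpha_2,\vec m_2)\cdots$ with $\alpha_i\in\mathbb{R}_{>0}$, $\vec m_i\in\mathcal{M}$; an infinite schedule is non-Zeno if $\sum_i\alpha_i=\infty$. A point $\vec x_0$ and a schedule $\pi$ induce the execution $\sigma$: with $\vec x_j=\vec x_{j-1}+\alpha_j\vec m_j$, $t_0=0$, $t_j=t_{j-1}+\alpha_j$, for $\tau\in[t_j,t_{j+1}]$ let $\sigma(\tau)=\vec x_j+\frac{\tau-t_j}{t_{j+1}-t_j}(\vec x_{j+1}-\vec x_j)$. A zone is a set $\{\vec x\in\mathbb{R}^d : A\vec x\le \vec b\}$ with $A\in\mathbb{Z}^{k\times d}$, $\vec b\in\mathbb{Z}^k$. LTL over a finite set $AP$ of zones has syntax $\varphi::=\mathrm{true}\mid Z\mid\neg\varphi\mid\varphi\land\varphi\mid\varphi\lor\varphi\mid \mathbf{F}\varphi\mid\mathbf{G}\varphi\mid\varphi\,\mathbf{U}\,\varphi$ ($Z\in AP$), interpreted over infinite executions at times $\tau\ge0$: $\sigma,\tau\models Z$ iff $\sigma(\tau)\in Z$; Boolean connectives as usual; $\sigma,\tau\models\mathbf{F}\varphi$ iff $\exists\tau'\ge\tau$: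 $\sigma,\tau'\models\varphi$; $\sigma,\tau\models\mathbf{G}\varphi$ iff $\forall\tau'\ge\tau$: $\sigma,\tau'\models\varphi$; $\sigma,\tau\models\varphi\,\mathbf{U}\,\varphi'$ iff $\exists\tau'\ge\tau$ with $\sigma,\tau'\models\varphi'$ and $\sigma,\tau''\models\varphi$ for all $\tau''\in[\tau,\tau')$. We write $\vec x\models_{\mathcal M}\varphi$ iff some non-Zeno infinite schedule $\pi$ of $\mathcal M$ induces from $\vec x$ an execution $\sigma$ with $\sigma,0\models\varphi$. For a set $X$ of operators, $\mathrm{LTL}_B(X)$ denotes the formulas using only operators from $X$ (besides $\mathrm{true}$ and zones) in which all zones are bounded. The model-checking problem for a fragment asks, given an MMS $\mathcal M$, a point $\vec x$ and a formula $\varphi$ of the fragment, whether $\vec x\models_{\mathcal M}\varphi$. *)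

theory Defs
  imports "Jordan_Normal_Form.Matrix" "HOL-Library.Nat_Bijection"
begin

section \<open>Partial recursive functions and decidability\<close>

datatype recf =
    Zero
  | Succ
  | Proj nat
  | Comp recf "recf list"
  | PrimRec recf recf
  | Mu recf

text \<open>\<open>computes f xs y\<close>: the partial recursive function denoted by \<open>f\<close> is defined on the
  arguments \<open>xs\<close> and has the value \<open>y\<close> there. Minimisation and primitive recursion act on the
  first argument.\<close>

inductive computes :: "recf \<Rightarrow> nat list \<Rightarrow> nat \<Rightarrow> bool" where
  computes_Zero: "computes Zero xs 0"
| computes_Succ: "computes Succ [x] (Suc x)"
| computes_Proj: "i < length xs \<Longrightarrow> computes (Proj i) xs (xs ! i)"
| computes_Comp: "list_all2 (\<lambda>g y. computes g xs y) gs ys \<Longrightarrow> computes f ys r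
    \<Longrightarrow> computes (Comp f gs) xs r"
| computes_PrimRec_0: "computes f xs r \<Longrightarrow> computes (PrimRec f g) (0 # xs) r"
| computes_PrimRec_Suc: "computes (PrimRec f g) (n # xs) r \<Longrightarrow> computes g (n # r # xs) s
    \<Longrightarrow> computes (PrimRec f g) (Suc n # xs) s"
| computes_Mu: "computes f (n # xs) 0 \<Longrightarrow> \<forall>m<n. \<exists>k. computes f (m # xs) (Suc k)
    \<Longrightarrow> computes (Mu f) xs n"

lemma computes_deterministic:
  "computes f xs y \<Longrightarrow> computes f xs z \<Longrightarrow> y = z"
proof (induction arbitrary: z rule: computes.induct)
  case (computes_Comp xs gs ys f r)
  from computes_Comp.prems obtain ys' where
    ys': "list_all2 (\<lambda>g y. computes g xs y) gs ys'" "computes f ys' z"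
    by (cases rule: computes.cases) auto
  have "ys = ys'"
    using computes_Comp(1) ys'(1) by (auto simp: list_all2_conv_all_nth intro!: nth_equalityI)
  then show ?case using computes_Comp.IH ys'(2) by blast
next
  case (computes_PrimRec_Suc f g n xs r s)
  from computes_PrimRec_Suc.prems obtain r' where
    "computes (PrimRec f g) (n # xs) r'" "computes g (n # r' # xs) z"
    by (cases rule: computes.cases) auto
  then show ?case using computes_PrimRec_Suc.IH by blast
next
  case (computes_Mu f n xs)
  from computes_Mu.prems have z: "computes f (z # xs) 0"
    "\<forall>m<z. \<exists>k. computes f (m # xs) (Suc k)"
    by (cases rule: computes.cases; simp)+
  show ?case
  proof (cases n z rule: linorder_cases)
    case less
    then show ?thesis using z(2) computes_Mu.IH(1) by blast
  next
    case greater
    then show ?thesis using z(1) computes_Mu.IH(2) by blast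
  qed
next
  case (computes_Zero xs)
  then show ?case by (cases rule: computes.cases) auto
next
  case (computes_Succ x)
  then show ?case by (cases rule: computes.cases) auto
next
  case (computes_Proj i xs)
  from computes_Proj.prems show ?case by (cases rule: computes.cases) auto
next
  case (computes_PrimRec_0 f xs r g)
  from computes_PrimRec_0.prems have "computes f xs z" by (cases rule: computes.cases) auto
  then show ?case by (rule computes_PrimRec_0.IH)
qed

text \<open>A decision problem is given by a set \<open>I\<close> of instances, an encoding of instances as
  natural numbers, and the property to be decided. The algorithm has to terminate with the correct
  answer on all instances; nothing is required of it on numbers that encode no instance.\<close>

definition decidable_problem :: "('i \<Rightarrow> nat) \<Rightarrow> 'i set \<Rightarrow> ('i \<Rightarrow> bool) \<Rightarrow> bool" where
  "decidable_problem enc I P \<longleftrightarrow>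
     (\<exists>f. \<forall>i\<in>I. computes f [enc i] (if P i then 1 else 0))"


section \<open>Multi-mode systems\<close>

definition mms :: "nat \<Rightarrow> real vec set \<Rightarrow> bool" where
  "mms d M \<longleftrightarrow> d \<ge> 1 \<and> finite M \<and> M \<subseteq> carrier_vec d"

text \<open>Only infinite schedules matter for the semantics; they are indexed from \<open>0\<close>.\<close>

type_synonym schedule = "nat \<Rightarrow> real \<times> real vec"

definition is_schedule :: "real vec set \<Rightarrow> schedule \<Rightarrow> bool" where
  "is_schedule M \<pi> \<longleftrightarrow> (\<forall>i. fst (\<pi> i) > 0 \<and> snd (\<pi> i) \<in> M)"

definition time :: "schedule \<Rightarrow> nat \<Rightarrow> real" where
  "time \<pi> j = (\<Sum>i<j. fst (\<pi> i))"

definition non_zeno :: "schedule \<Rightarrow> bool" where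
  "non_zeno \<pi> \<longleftrightarrow> filterlim (time \<pi>) at_top sequentially"

fun point :: "real vec \<Rightarrow> schedule \<Rightarrow> nat \<Rightarrow> real vec" where
  "point x \<pi> 0 = x"
| "point x \<pi> (Suc j) = point x \<pi> j + fst (\<pi> j) \<cdot>\<^sub>v snd (\<pi> j)"

text \<open>For a non-Zeno schedule this determines \<open>\<sigma>\<close> on all nonnegative times; its values at
  negative times are irrelevant.\<close>

definition induces :: "real vec \<Rightarrow> schedule \<Rightarrow> (real \<Rightarrow> real vec) \<Rightarrow> bool" where
  "induces x \<pi> \<sigma> \<longleftrightarrow> (\<forall>j. \<forall>\<tau> \<in> {time \<pi> j .. time \<pi> (Suc j)}.
     \<sigma> \<tau> = point x \<pi> j
       + ((\<tau> - time \<pi> j) / (time \<pi> (Suc j) - time \<pi> j)) \<cdot>\<^sub>v (point x \<pi> (Suc j) - point x \<pi> j))"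


section \<open>Linear temporal logic over zones\<close>

text \<open>A zone is given syntactically, by its matrix and right-hand side.\<close>

type_synonym zone = "int mat \<times> int vec"

definition is_zone :: "nat \<Rightarrow> zone \<Rightarrow> bool" where
  "is_zone d Z \<longleftrightarrow> dim_col (fst Z) = d \<and> dim_row (fst Z) = dim_vec (snd Z)"

text \<open>The order on vectors is componentwise.\<close>

definition zone_set :: "zone \<Rightarrow> real vec set" where
  "zone_set Z = {x \<in> carrier_vec (dim_col (fst Z)).
     map_mat real_of_int (fst Z) *\<^sub>v x \<le> map_vec real_of_int (snd Z)}"

definition bounded_zone :: "zone \<Rightarrow> bool" where
  "bounded_zone Z \<longleftrightarrow> (\<exists>B. \<forall>x \<in> zone_set Z. \<forall>i < dim_vec x. \<bar>x $ i\<bar> \<le> B)"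

datatype ltl =
    TrueF
  | Atom zone
  | Neg ltl
  | Conj ltl ltl
  | Disj ltl ltl
  | Finally ltl
  | Globally ltl
  | Until ltl ltl

fun sat :: "(real \<Rightarrow> real vec) \<Rightarrow> real \<Rightarrow> ltl \<Rightarrow> bool" where
  "sat \<sigma> \<tau> TrueF \<longleftrightarrow> True"
| "sat \<sigma> \<tau> (Atom Z) \<longleftrightarrow> \<sigma> \<tau> \<in> zone_set Z"
| "sat \<sigma> \<tau> (Neg \<phi>) \<longleftrightarrow> \<not> sat \<sigma> \<tau> \<phi>"
| "sat \<sigma> \<tau> (Conj \<phi> \<psi>) \<longleftrightarrow> sat \<sigma> \<tau> \<phi> \<and> sat \<sigma> \<tau> \<psi>"
| "sat \<sigma> \<tau> (Disj \<phi> \<psi>) \<longleftrightarrow> sat \<sigma> \<tau> \<phi> \<or> sat \<sigma> \<tau> \<psi>"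
| "sat \<sigma> \<tau> (Finally \<phi>) \<longleftrightarrow> (\<exists>\<tau>'\<ge>\<tau>. sat \<sigma> \<tau>' \<phi>)"
| "sat \<sigma> \<tau> (Globally \<phi>) \<longleftrightarrow> (\<forall>\<tau>'\<ge>\<tau>. sat \<sigma> \<tau>' \<phi>)"
| "sat \<sigma> \<tau> (Until \<phi> \<psi>) \<longleftrightarrow> (\<exists>\<tau>'\<ge>\<tau>. sat \<sigma> \<tau>' \<psi> \<and> (\<forall>\<tau>''\<in>{\<tau>..<\<tau>'}. sat \<sigma> \<tau>'' \<phi>))"

definition models :: "real vec set \<Rightarrow> real vec \<Rightarrow> ltl \<Rightarrow> bool" where
  "models M x \<phi> \<longleftrightarrow>
     (\<exists>\<pi> \<sigma>. is_schedule M \<pi> \<and> non_zeno \<pi> \<and> induces x \<pi> \<sigma> \<and> sat \<sigma> 0 \<phi>)"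

datatype ltl_op = NotOp | AndOp | OrOp | FOp | GOp | UOp

fun operators :: "ltl \<Rightarrow> ltl_op set" where
  "operators TrueF = {}"
| "operators (Atom Z) = {}"
| "operators (Neg \<phi>) = insert NotOp (operators \<phi>)"
| "operators (Conj \<phi> \<psi>) = insert AndOp (operators \<phi> \<union> operators \<psi>)"
| "operators (Disj \<phi> \<psi>) = insert OrOp (operators \<phi> \<union> operators \<psi>)"
| "operators (Finally \<phi>) = insert FOp (operators \<phi>)"
| "operators (Globally \<phi>) = insert GOp (operators \<phi>)"
| "operators (Until \<phi> \<psi>) = insert UOp (operators \<phi> \<union> operators \<psi>)"

fun zones :: "ltl \<Rightarrow> zone set" where
  "zones TrueF = {}"
| "zones (Atom Z) = {Z}"
| "zones (Neg \<phi>) = zones \<phi>"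
| "zones (Conj \<phi> \<psi>) = zones \<phi> \<union> zones \<psi>"
| "zones (Disj \<phi> \<psi>) = zones \<phi> \<union> zones \<psi>"
| "zones (Finally \<phi>) = zones \<phi>"
| "zones (Globally \<phi>) = zones \<phi>"
| "zones (Until \<phi> \<psi>) = zones \<phi> \<union> zones \<psi>"

definition LTL\<^sub>B :: "nat \<Rightarrow> ltl_op set \<Rightarrow> ltl set" where
  "LTL\<^sub>B d X = {\<phi>. operators \<phi> \<subseteq> X \<and> (\<forall>Z \<in> zones \<phi>. is_zone d Z \<and> bounded_zone Z)}"


section \<open>The model-checking problem\<close>

text \<open>To be an input of an algorithm, an instance must have a finite representation. Hence its
  modes and its point are rational, and its finite set of modes is presented by a list.\<close>

datatype mc_instance =
  MC (dimension: nat) (modes: "rat vec list") (start: "rat vec") (formula: ltl)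

definition mode_set :: "mc_instance \<Rightarrow> real vec set" where
  "mode_set I = map_vec real_of_rat ` set (modes I)"

definition start_point :: "mc_instance \<Rightarrow> real vec" where
  "start_point I = map_vec real_of_rat (start I)"

definition mc_instances :: "ltl_op set \<Rightarrow> mc_instance set" where
  "mc_instances X = {I. mms (dimension I) (mode_set I)
     \<and> start_point I \<in> carrier_vec (dimension I) \<and> formula I \<in> LTL\<^sub>B (dimension I) X}"

definition mc_holds :: "mc_instance \<Rightarrow> bool" where
  "mc_holds I \<longleftrightarrow> models (mode_set I) (start_point I) (formula I)"


subsection \<open>Encoding of instances as natural numbers\<close>

definition encode_rat :: "rat \<Rightarrow> nat" where
  "encode_rat q = (case quotient_of q of (a, b) \<Rightarrow> prod_encode (int_encode a, int_encode b))"

definition encode_vec :: "('a \<Rightarrow> nat) \<Rightarrow> 'a vec \<Rightarrow> nat" where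
  "encode_vec e v = list_encode (map e (list_of_vec v))"

text \<open>The number of columns is recorded since it cannot be recovered from an empty list of rows.\<close>

definition encode_mat :: "('a \<Rightarrow> nat) \<Rightarrow> 'a mat \<Rightarrow> nat" where
  "encode_mat e A = prod_encode (dim_col A, list_encode (map (encode_vec e) (rows A)))"

definition encode_zone :: "zone \<Rightarrow> nat" where
  "encode_zone Z = prod_encode (encode_mat int_encode (fst Z), encode_vec int_encode (snd Z))"

fun encode_ltl :: "ltl \<Rightarrow> nat" where
  "encode_ltl TrueF = prod_encode (0, 0)"
| "encode_ltl (Atom Z) = prod_encode (1, encode_zone Z)"
| "encode_ltl (Neg \<phi>) = prod_encode (2, encode_ltl \<phi>)"
| "encode_ltl (Conj \<phi> \<psi>) = prod_encode (3, prod_encode (encode_ltl \<phi>, encode_ltl \<psi>))"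
| "encode_ltl (Disj \<phi> \<psi>) = prod_encode (4, prod_encode (encode_ltl \<phi>, encode_ltl \<psi>))"
| "encode_ltl (Finally \<phi>) = prod_encode (5, encode_ltl \<phi>)"
| "encode_ltl (Globally \<phi>) = prod_encode (6, encode_ltl \<phi>)"
| "encode_ltl (Until \<phi> \<psi>) = prod_encode (7, prod_encode (encode_ltl \<phi>, encode_ltl \<psi>))"

definition encode_instance :: "mc_instance \<Rightarrow> nat" where
  "encode_instance I = list_encode
     [dimension I, list_encode (map (encode_vec encode_rat) (modes I)),
      encode_vec encode_rat (start I), encode_ltl (formula I)]"

lemma inj_encode_rat: "inj encode_rat"
  by (rule injI) (auto simp: encode_rat_def int_encode_eq split: prod.splits
      intro: quotient_of_inject)

lemma inj_encode_vec: "inj e \<Longrightarrow> inj (encode_vec e)"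
  by (rule injI) (metis encode_vec_def inj_map_eq_map list_encode_eq vec_list)

lemma inj_encode_mat:
  assumes "inj e" shows "inj (encode_mat e)"
proof (rule injI)
  fix A B assume "encode_mat e A = encode_mat e B"
  then have "dim_col A = dim_col B" "rows A = rows B"
    using inj_map_eq_map[OF inj_encode_vec[OF assms]]
    by (auto simp: encode_mat_def list_encode_eq)
  then show "A = B" by (metis mat_of_rows_rows)
qed

lemma encode_zone_eq: "encode_zone Z = encode_zone Z' \<longleftrightarrow> Z = Z'"
  using inj_encode_mat[OF inj_int_encode] inj_encode_vec[OF inj_int_encode]
  by (auto simp: encode_zone_def inj_eq prod_eq_iff)

lemma encode_ltl_eq: "encode_ltl \<phi> = encode_ltl \<psi> \<longleftrightarrow> \<phi> = \<psi>"
proof (induction \<phi> arbitrary: \<psi>)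
  case TrueF show ?case by (cases \<psi>) auto
next
  case (Atom Z) show ?case by (cases \<psi>) (auto simp: encode_zone_eq)
next
  case Neg then show ?case by (cases \<psi>) auto
next
  case Conj then show ?case by (cases \<psi>) auto
next
  case Disj then show ?case by (cases \<psi>) auto
next
  case Finally then show ?case by (cases \<psi>) auto
next
  case Globally then show ?case by (cases \<psi>) auto
next
  case Until then show ?case by (cases \<psi>) auto
qed

lemma inj_encode_instance: "inj encode_instance"
proof (rule injI)
  fix I J assume eq: "encode_instance I = encode_instance J"
  have inj: "inj (encode_vec encode_rat)"
    by (rule inj_encode_vec[OF inj_encode_rat])
  from eq have "dimension I = dimension J"
    and "map (encode_vec encode_rat) (modes I) = map (encode_vec encode_rat) (modes J)"
    and "encode_vec encode_rat (start I) = encode_vec encode_rat (start J)"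
    and "encode_ltl (formula I) = encode_ltl (formula J)"
    unfolding encode_instance_def list_encode_eq list.inject by (auto simp only: list_encode_eq)
  then show "I = J"
    by (intro mc_instance.expand)
       (simp add: inj_map_eq_map[OF inj] inj_eq[OF inj] encode_ltl_eq)
qed

end

theory Submission
  imports Defs
begin

text \<open>Suppose that a recursive function \<open>f\<close> decides the problem. A counter machine computing with \<open>f\<close> is
  simulated by a multi-mode system: a counter \<open>a\<close> is stored as \<open>1 / 2 ^ a\<close>, so that one step of the
  machine is a finite union of systems of linear equations between the old and the new
  configuration. Additional coordinates force the trajectory to run around a cycle, on which the
  new configuration is guessed, checked against these equations, and copied. Staying in the union
  of the zones of the edges forever means that the machine does not halt, which is a formula with
  \<open>G\<close> and \<open>\<or>\<close>. Since every round visits the zones in a fixed order, a nested \<open>U\<close> can express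
  membership in the union until a halting configuration is reached.

  The system and the formula depend only on the machine, and the input only affects the starting
  point. Hence no universal machine is needed for the diagonal argument: the input consists of
  the codes of the parts of the instance itself, from which \<open>r_instance\<close> assembles the code of the
  instance that is passed to \<open>f\<close>.\<close>

section \<open>Compiling recursive functions to loop programs\<close>

text \<open>Two difficulties shape the construction. A schedule may switch modes at will and
  arbitrarily fast, so only the zones can keep an execution from cutting a corner or skipping a
  check. The control coordinates are therefore barycentric coordinates on a cycle with at least four
  vertices: a mode that belongs to another edge leaves the union of the edges, and an interior point
  of an edge lies in no zone of another edge. A check is thus in force on the whole interior of its
  edge, while the data are at rest. Since every mode moves the control point at unit speed, time
  counts the traversed edges.

  The second difficulty is self-reference: the starting point has to describe the instance of which
  it is a part. Only its four leading coordinates vary; all others, the padding, are fixed in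
  advance. The input can therefore contain the code of the padding, from which the code of the whole
  point is computed.

  Powers of 1/2 keep the data in the unit interval however large the counters grow, so that bounded
  zones suffice.\<close>

datatype com =
    Clear nat
  | Copy nat nat
  | Inc nat
  | Seq com com
  | Loop nat com

inductive exec :: "com \<Rightarrow> (nat \<Rightarrow> nat) \<Rightarrow> (nat \<Rightarrow> nat) \<Rightarrow> bool" where
  exec_Clear: "exec (Clear r) v (v(r := 0))"
| exec_Copy: "exec (Copy r s) v (v(r := v s))"
| exec_Inc: "exec (Inc r) v (v(r := Suc (v r)))"
| exec_Seq: "exec c u v \<Longrightarrow> exec d v w \<Longrightarrow> exec (Seq c d) u w"
| exec_Loop_0: "v r = 0 \<Longrightarrow> exec (Loop r c) v v"
| exec_Loop_Suc: "v r = Suc n \<Longrightarrow> exec c (v(r := n)) u \<Longrightarrow> exec (Loop r c) u w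
    \<Longrightarrow> exec (Loop r c) v w"

text \<open>The arguments are code generators, so that \<open>compile\<close> can recurse through
  \<open>map compile\<close>. \<open>Clear b\<close> stands for a no-op, register \<open>b\<close>
  being scratch.\<close>

fun compile_args :: "(nat list \<Rightarrow> nat \<Rightarrow> nat \<Rightarrow> com) list \<Rightarrow> nat list \<Rightarrow> nat \<Rightarrow> nat \<Rightarrow> com" where
  "compile_args [] rs t b = Clear b"
| "compile_args (g # gs) rs t b = Seq (g rs t b) (compile_args gs rs (Suc t) b)"

text \<open>\<open>compile f rs out b\<close> reads its arguments from the registers \<open>rs\<close>, writes the result to
  \<open>out\<close>, and uses the registers from \<open>b\<close> on as scratch space.\<close>

primrec compile :: "recf \<Rightarrow> nat list \<Rightarrow> nat \<Rightarrow> nat \<Rightarrow> com" where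
  "compile Zero = (\<lambda>rs out b. Clear out)"
| "compile Succ = (\<lambda>rs out b. Seq (Copy out (rs ! 0)) (Inc out))"
| "compile (Proj i) = (\<lambda>rs out b. Copy out (rs ! i))"
| "compile (Comp f gs) = (\<lambda>rs out b. let b' = b + length gs in
     Seq (compile_args (map compile gs) rs b b') (compile f [b..<b'] out b'))"
| "compile (PrimRec f g) = (\<lambda>rs out b.
     Seq (Clear b) (Seq (Copy (b + 1) (hd rs)) (Seq (compile f (tl rs) (b + 2) (b + 4))
      (Seq (Loop (b + 1) (Seq (compile g (b # (b + 2) # tl rs) (b + 3) (b + 4))
                          (Seq (Copy (b + 2) (b + 3)) (Inc b))))
           (Copy out (b + 2))))))"
| "compile (Mu f) = (\<lambda>rs out b.
     Seq (Clear b) (Seq (compile f (b # rs) (b + 1) (b + 2))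
      (Seq (Loop (b + 1) (Seq (Inc b) (compile f (b # rs) (b + 1) (b + 2))))
           (Copy out b))))"

definition agree :: "nat \<Rightarrow> (nat \<Rightarrow> nat) \<Rightarrow> (nat \<Rightarrow> nat) \<Rightarrow> bool" where
  "agree b v w \<longleftrightarrow> (\<forall>r<b. v r = w r)"

definition implements :: "(nat list \<Rightarrow> nat \<Rightarrow> nat \<Rightarrow> com) \<Rightarrow> recf \<Rightarrow> bool" where
  "implements C f \<longleftrightarrow> (\<forall>rs out b v xs y. computes f xs y \<longrightarrow> xs = map v rs \<longrightarrow> set rs \<subseteq> {..<b}
     \<longrightarrow> out < b \<longrightarrow> out \<notin> set rs \<longrightarrow> (\<exists>w. exec (C rs out b) v w \<and> agree b w (v(out := y))))"

lemma implementsD: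
  assumes "implements C f" "computes f (map v rs) y" "set rs \<subseteq> {..<b}" "out < b" "out \<notin> set rs"
  shows "\<exists>w. exec (C rs out b) v w \<and> agree b w (v(out := y))"
  using assms unfolding implements_def by blast

inductive_cases exec_SeqE: "exec (Seq c d) u w"
inductive_cases computes_ZeroE: "computes Zero xs y"
inductive_cases computes_SuccE: "computes Succ xs y"
inductive_cases computes_ProjE: "computes (Proj i) xs y"
inductive_cases computes_CompE: "computes (Comp f gs) xs y"
inductive_cases computes_PrimRec_0E: "computes (PrimRec f g) (0 # xs) y"
inductive_cases computes_PrimRec_SucE: "computes (PrimRec f g) (Suc n # xs) y"
inductive_cases computes_PrimRecE: "computes (PrimRec f g) xs y"
inductive_cases computes_MuE: "computes (Mu f) xs y"

text \<open>All calls share the scratch registers from \<open>b\<close> on, above the slots for the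
  results, so a result once stored survives the later calls.\<close>

lemma compile_args_correct:
  assumes "list_all2 (\<lambda>g y. computes g xs y) gs ys" and "xs = map v rs"
    and "\<forall>g\<in>set gs. implements (compile g) g"
    and "set rs \<subseteq> {..<t}" "t + length gs = b"
  shows "\<exists>w. exec (compile_args (map compile gs) rs t b) v w \<and> agree t w v
    \<and> map w [t..<b] = ys"
  using assms
proof (induction gs ys arbitrary: t v rule: list_all2_induct)
  case Nil
  show ?case using Nil.prems
    by (auto simp: agree_def intro!: exI[of _ "v(b := 0)"] exec_Clear)
next
  case (Cons g gs y ys)
  have rs: "set rs \<subseteq> {..<b}" "t < b" "t \<notin> set rs" using Cons.prems by auto
  have "implements (compile g) g" using Cons.prems(2) by simp
  from implementsD[OF this Cons.hyps(1)[unfolded Cons.prems(1)] rs]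
  obtain u where u: "exec (compile g rs t b) v u" "agree b u (v(t := y))" by blast
  have same: "map u rs = map v rs" using u(2) Cons.prems(3,4) rs by (auto simp: agree_def)
  have "\<exists>w. exec (compile_args (map compile gs) rs (Suc t) b) u w \<and> agree (Suc t) w u
    \<and> map w [Suc t..<b] = ys"
    using Cons.hyps(2) Cons.prems by (intro Cons.IH) (auto simp: same)
  then obtain w where w: "exec (compile_args (map compile gs) rs (Suc t) b) u w"
    "agree (Suc t) w u" "map w [Suc t..<b] = ys" by blast
  have "map w [t..<b] = y # ys"
    using w u rs by (auto simp: upt_conv_Cons agree_def)
  moreover have "agree t w v" using w u rs by (auto simp: agree_def)
  ultimately show ?case using u w by (auto intro: exec_Seq)
qed

lemma compile_Comp:
  assumes f: "implements (compile f) f" and gs: "\<forall>g\<in>set gs. implements (compile g) g"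
  shows "implements (compile (Comp f gs)) (Comp f gs)"
  unfolding implements_def
proof (intro allI impI)
  fix rs xs :: "nat list" and out b y :: nat and v :: "nat \<Rightarrow> nat"
  assume c: "computes (Comp f gs) xs y" and xs: "xs = map v rs"
    and rs: "set rs \<subseteq> {..<b}" "out < b" "out \<notin> set rs"
  from c obtain ys where ys: "list_all2 (\<lambda>g y. computes g xs y) gs ys" "computes f ys y"
    by (rule computes_CompE)
  define b' where "b' = b + length gs"
  obtain u where u: "exec (compile_args (map compile gs) rs b b') v u" "agree b u v"
    "map u [b..<b'] = ys"
    using compile_args_correct[OF ys(1) xs gs rs(1) b'_def[symmetric]] by blast
  obtain w where w: "exec (compile f [b..<b'] out b') u w" "agree b' w (u(out := y))"
    using implementsD[OF f, of u "[b..<b']" y b' out] ys(2) u(3) rs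
    by (fastforce simp: b'_def)
  have "exec (compile (Comp f gs) rs out b) v w"
    using exec_Seq[OF u(1) w(1)] by (simp add: Let_def b'_def)
  moreover have "agree b w (v(out := y))" using u(2) w(2) by (auto simp: agree_def b'_def)
  ultimately show "\<exists>w. exec (compile (Comp f gs) rs out b) v w \<and> agree b w (v(out := y))" by blast
qed

lemma compile_PrimRec:
  assumes f: "implements (compile f) f" and g: "implements (compile g) g"
  shows "implements (compile (PrimRec f g)) (PrimRec f g)"
  unfolding implements_def
proof (intro allI impI)
  fix rs xs :: "nat list" and out b y :: nat and v :: "nat \<Rightarrow> nat"
  assume c: "computes (PrimRec f g) xs y" and xs: "xs = map v rs"
    and rs: "set rs \<subseteq> {..<b}" "out < b" "out \<notin> set rs"
  from c xs obtain a rs' where rs_eq: "rs = a # rs'"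
    by (cases rs) (auto elim: computes_PrimRecE)
  define c where "c = Seq (compile g (b # (b + 2) # rs') (b + 3) (b + 4))
                          (Seq (Copy (b + 2) (b + 3)) (Inc b))"
  define v1 where "v1 = v(b := 0, b + 1 := v a)"
  have ab: "a < b" "set rs' \<subseteq> {..<b}" using rs rs_eq by auto
  have v1_as: "map v1 rs' = map v rs'" using ab by (auto simp: v1_def)
  \<comment> \<open>\<open>exec_Loop_Suc\<close> adds an iteration at the front of a loop, whereas
    the induction on \<open>n\<close> adds one at the end. The state \<open>u\<close> after
    \<open>n\<close> rounds is therefore described by a continuation: every execution of the loop
    from \<open>u\<close> extends to one from \<open>v1\<close>.\<close>
  have key: "computes (PrimRec f g) (n # map v rs') r \<Longrightarrow> v a = m + n \<Longrightarrow>
      \<exists>u. (\<forall>w. exec (Loop (b + 1) c) u w \<longrightarrow>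
             exec (Seq (compile f rs' (b + 2) (b + 4)) (Loop (b + 1) c)) v1 w)
        \<and> agree b u v \<and> u b = n \<and> u (b + 1) = m \<and> u (b + 2) = r" for n m r
  proof (induction n arbitrary: m r)
    case 0
    then have "computes f (map v1 rs') r" unfolding v1_as by (auto elim: computes_PrimRec_0E)
    then obtain u where u: "exec (compile f rs' (b + 2) (b + 4)) v1 u"
      "agree (b + 4) u (v1(b + 2 := r))"
      using implementsD[OF f, of v1 rs' r "b + 4" "b + 2"] ab by fastforce
    then show ?case using 0 ab
      by (intro exI[of _ u] conjI allI impI exec_Seq[OF u(1)]) (auto simp: agree_def v1_def)
  next
    case (Suc n)
    from Suc.prems(1) obtain q where q: "computes (PrimRec f g) (n # map v rs') q"
      "computes g (n # q # map v rs') r" by (auto elim: computes_PrimRec_SucE)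
    obtain u where u: "\<And>w. exec (Loop (b + 1) c) u w \<Longrightarrow>
             exec (Seq (compile f rs' (b + 2) (b + 4)) (Loop (b + 1) c)) v1 w"
       "agree b u v" "u b = n" "u (b + 1) = Suc m" "u (b + 2) = q"
      using Suc.IH[OF q(1), of "Suc m"] Suc.prems(2) by auto
    define u1 where "u1 = u(b + 1 := m)"
    have "map u1 (b # (b + 2) # rs') = n # q # map v rs'"
      using u ab by (auto simp: u1_def agree_def)
    then have "computes g (map u1 (b # (b + 2) # rs')) r" using q(2) by (simp only:)
    moreover have "set (b # (b + 2) # rs') \<subseteq> {..<b + 4}" "b + 3 \<notin> set (b # (b + 2) # rs')"
      using ab by auto
    ultimately obtain u2 where u2: "exec (compile g (b # (b + 2) # rs') (b + 3) (b + 4)) u1 u2"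
      "agree (b + 4) u2 (u1(b + 3 := r))"
      using implementsD[OF g, of u1 "b # (b + 2) # rs'" r "b + 4" "b + 3"] by auto
    define u3 where "u3 = u2(b + 2 := u2 (b + 3), b := Suc (u2 b))"
    have "exec c u1 u3" unfolding c_def u3_def
      by (rule exec_Seq[OF u2(1)], rule exec_Seq[OF exec_Copy])
         (use exec_Inc[of b "u2(b + 2 := u2 (b + 3))"] in simp)
    then have "exec (Loop (b + 1) c) u w" if "exec (Loop (b + 1) c) u3 w" for w
      using that u(4) unfolding u1_def by (rule exec_Loop_Suc[rotated])
    moreover have "agree b u3 v" "u3 b = Suc n" "u3 (b + 1) = m" "u3 (b + 2) = r"
      using u2(2) u by (auto simp: agree_def u3_def u1_def)
    ultimately show ?case using u(1) by blast
  qed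
  have "computes (PrimRec f g) (v a # map v rs') y" using c xs rs_eq \<open>computes _ xs y\<close> by simp
  from key[OF this, of 0] obtain u where
    u: "\<And>w. exec (Loop (b + 1) c) u w \<Longrightarrow>
             exec (Seq (compile f rs' (b + 2) (b + 4)) (Loop (b + 1) c)) v1 w"
       "agree b u v" "u b = v a" "u (b + 1) = 0" "u (b + 2) = y" by auto
  from u(1)[OF exec_Loop_0[of u "b + 1" c, OF u(4)]] obtain v2 where
    v2: "exec (compile f rs' (b + 2) (b + 4)) v1 v2" "exec (Loop (b + 1) c) v2 u"
    by (auto elim: exec_SeqE)
  have v1': "v1 = (v(b := 0))(b + 1 := (v(b := 0)) a)" using ab by (auto simp: v1_def)
  have "exec (compile (PrimRec f g) rs out b) v (u(out := u (b + 2)))"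
    unfolding compile.simps rs_eq list.sel
    by (rule exec_Seq[OF exec_Clear exec_Seq[OF exec_Copy exec_Seq[OF _ exec_Seq[OF _ exec_Copy]]]])
      (use v2 in \<open>simp_all add: v1' c_def\<close>)
  moreover have "agree b (u(out := u (b + 2))) (v(out := y))" using u by (auto simp: agree_def)
  ultimately show "\<exists>w. exec (compile (PrimRec f g) rs out b) v w \<and> agree b w (v(out := y))"
    by blast
qed

lemma compile_Mu:
  assumes f: "implements (compile f) f"
  shows "implements (compile (Mu f)) (Mu f)"
  unfolding implements_def
proof (intro allI impI)
  fix rs xs :: "nat list" and out b y :: nat and v :: "nat \<Rightarrow> nat"
  assume c: "computes (Mu f) xs y" and xs: "xs = map v rs"
    and rs: "set rs \<subseteq> {..<b}" "out < b" "out \<notin> set rs"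
  from c have fy: "computes f (y # xs) 0" "\<forall>m<y. \<exists>k. computes f (m # xs) (Suc k)"
    by (auto elim: computes_MuE)
  define C where "C = compile f (b # rs) (b + 1) (b + 2)"
  define L where "L = Loop (b + 1) (Seq (Inc b) C)"
  have run: "\<exists>w. exec C u w \<and> agree b w v \<and> w b = u b \<and> w (b + 1) = r"
    if u: "agree b u v" "computes f (u b # xs) r" for u r
  proof -
    have "map u (b # rs) = u b # xs" using u(1) rs xs by (auto simp: agree_def)
    then have "computes f (map u (b # rs)) r" using u(2) by simp
    moreover have "set (b # rs) \<subseteq> {..<b + 2}" "b + 1 \<notin> set (b # rs)" using rs by auto
    ultimately obtain w where "exec C u w" "agree (b + 2) w (u(b + 1 := r))"
      using implementsD[OF f, of u "b # rs" r "b + 2" "b + 1"] unfolding C_def by auto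
    then show ?thesis using u(1) by (intro exI[of _ w]) (auto simp: agree_def)
  qed
  \<comment> \<open>Register \<open>b + 1\<close> holds the value of \<open>f\<close> at the
    candidate in \<open>b\<close>; by determinism it is positive while the candidate is below
    \<open>y\<close>, and zero at \<open>y\<close>.\<close>
  have loop: "\<exists>w. exec L u w \<and> agree b w v \<and> w b = y"
    if "agree b u v" "u b \<le> y" "computes f (u b # xs) (u (b + 1))" for u
    using that
  proof (induction "y - u b" arbitrary: u rule: less_induct)
    case less
    show ?case
    proof (cases "u b = y")
      case True
      then have "u (b + 1) = 0" using less.prems(3) fy(1) computes_deterministic by metis
      then show ?thesis using True less.prems unfolding L_def by (blast intro: exec_Loop_0)
    next
      case False
      then have lt: "u b < y" using less.prems by simp
      then obtain k where k: "u (b + 1) = Suc k"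
        using fy(2) less.prems(3) computes_deterministic by metis
      define u1 where "u1 = u(b + 1 := k, b := Suc (u b))"
      have "\<exists>r. computes f (Suc (u b) # xs) r"
        using fy lt by (cases "Suc (u b) = y") (use Suc_lessI in blast)+
      then obtain r where "computes f (u1 b # xs) r" by (auto simp: u1_def)
      moreover have "agree b u1 v" using less.prems by (auto simp: agree_def u1_def)
      ultimately obtain u2 where u2: "exec C u1 u2" "agree b u2 v" "u2 b = u1 b"
        "computes f (u2 b # xs) (u2 (b + 1))" using run[of u1 r] by auto
      have "\<exists>w. exec L u2 w \<and> agree b w v \<and> w b = y"
        using lt u2 by (intro less.hyps) (auto simp: u1_def)
      then obtain w where w: "exec L u2 w" "agree b w v" "w b = y" by blast
      have "exec (Inc b) (u(b + 1 := k)) u1"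
        using exec_Inc[of b "u(b + 1 := k)"] by (simp add: u1_def)
      then have "exec (Seq (Inc b) C) (u(b + 1 := k)) u2" using u2(1) by (rule exec_Seq)
      then have "exec L u w"
        using exec_Loop_Suc[of u "b + 1" k] k w(1) unfolding L_def by blast
      then show ?thesis using w by blast
    qed
  qed
  have "\<exists>r. computes f (0 # xs) r" using fy by (cases y) auto
  then obtain r where r: "computes f ((v(b := 0)) b # xs) r" by auto
  obtain u where u: "exec C (v(b := 0)) u" "agree b u v" "u b = 0" "u (b + 1) = r"
    using run[of "v(b := 0)", OF _ r] by (auto simp: agree_def)
  obtain w where w: "exec L u w" "agree b w v" "w b = y"
    using loop[of u] u r by auto
  have "exec (compile (Mu f) rs out b) v (w(out := w b))"
    unfolding compile.simps
    by (rule exec_Seq[OF exec_Clear exec_Seq[OF _ exec_Seq[OF _ exec_Copy]]])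
      (use u w in \<open>simp_all add: C_def L_def\<close>)
  moreover have "agree b (w(out := w b)) (v(out := y))" using w by (auto simp: agree_def)
  ultimately show "\<exists>w. exec (compile (Mu f) rs out b) v w \<and> agree b w (v(out := y))" by blast
qed

lemma compile_correct: "implements (compile f) f"
proof (induction f)
  case Zero
  have "y = 0" if "computes Zero xs y" for xs y using that by (rule computes_ZeroE)
  then show ?case by (fastforce simp: implements_def agree_def intro: exec_Clear)
next
  case Succ
  show ?case unfolding implements_def
  proof (intro allI impI)
    fix rs xs :: "nat list" and out b y :: nat and v :: "nat \<Rightarrow> nat"
    assume "computes Succ xs y" "xs = map v rs"
    then have "y = Suc (v (rs ! 0))" by (auto elim: computes_SuccE)
    then have "exec (compile Succ rs out b) v (v(out := y))"
      using exec_Seq[OF exec_Copy[of out "rs ! 0" v] exec_Inc[of out]] by simp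
    then show "\<exists>w. exec (compile Succ rs out b) v w \<and> agree b w (v(out := y))"
      by (auto simp: agree_def)
  qed
next
  case (Proj i)
  have "i < length xs \<and> y = xs ! i" if "computes (Proj i) xs y" for xs y
    using that by (auto elim: computes_ProjE)
  then show ?case
    using exec_Copy by (fastforce simp: implements_def agree_def)
next
  case Comp then show ?case by (intro compile_Comp) auto
next
  case PrimRec then show ?case by (rule compile_PrimRec)
next
  case Mu then show ?case by (rule compile_Mu)
qed


section \<open>Goto programs\<close>

datatype instr =
    IClear nat nat
  | ICopy nat nat nat
  | IInc nat nat
  | IJzd nat nat nat

fun perform :: "instr \<Rightarrow> (nat \<Rightarrow> nat) \<Rightarrow> nat \<times> (nat \<Rightarrow> nat)" where
  "perform (IClear r q) v = (q, v(r := 0))"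
| "perform (ICopy r s q) v = (q, v(r := v s))"
| "perform (IInc r q) v = (q, v(r := Suc (v r)))"
| "perform (IJzd r q q') v = (if v r = 0 then (q, v) else (q', v(r := v r - 1)))"

definition halted :: "instr list \<Rightarrow> nat \<times> (nat \<Rightarrow> nat) \<Rightarrow> bool" where
  "halted prog c \<longleftrightarrow> length prog \<le> fst c"

definition step :: "instr list \<Rightarrow> nat \<times> (nat \<Rightarrow> nat) \<Rightarrow> nat \<times> (nat \<Rightarrow> nat)" where
  "step prog c = (if halted prog c then c else perform (prog ! fst c) (snd c))"

text \<open>\<open>ICopy 0 0 p\<close> copies a register to itself and so serves as a plain jump to
  \<open>p\<close>.\<close>

fun code :: "com \<Rightarrow> nat \<Rightarrow> instr list" where
  "code (Clear r) p = [IClear r (Suc p)]"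
| "code (Copy r s) p = [ICopy r s (Suc p)]"
| "code (Inc r) p = [IInc r (Suc p)]"
| "code (Seq c d) p = code c p @ code d (p + length (code c p))"
| "code (Loop r c) p =
     IJzd r (p + length (code c (Suc p)) + 2) (Suc p) # code c (Suc p) @ [ICopy 0 0 p]"

lemma step_nth: "prog = pre @ i # post \<Longrightarrow> length pre = p \<Longrightarrow> step prog (p, v) = perform i v"
  by (auto simp: step_def halted_def)

lemma funpow_trans:
  "(f ^^ m) x = y \<Longrightarrow> (f ^^ n) y = z \<Longrightarrow> \<exists>k. (f ^^ k) x = z"
  by (rule exI[of _ "n + m"]) (simp add: funpow_add)

lemma exec_code:
  "exec c v w \<Longrightarrow> prog = pre @ code c p @ post \<Longrightarrow> length pre = p
   \<Longrightarrow> \<exists>n. (step prog ^^ n) (p, v) = (p + length (code c p), w)"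
proof (induction arbitrary: pre post p rule: exec.induct)
  case (exec_Seq c u v d w)
  obtain n where n: "(step prog ^^ n) (p, u) = (p + length (code c p), v)"
    using exec_Seq.IH(1)[of pre p "code d (p + length (code c p)) @ post"] exec_Seq.prems by auto
  obtain m where "(step prog ^^ m) (p + length (code c p), v)
      = (p + length (code c p) + length (code d (p + length (code c p))), w)"
    using exec_Seq.IH(2)[of "pre @ code c p" "p + length (code c p)" post] exec_Seq.prems by auto
  from funpow_trans[OF n this] show ?case by (simp add: add.assoc)
next
  case (exec_Loop_0 v r c)
  then have "step prog (p, v) = (p + length (code c (Suc p)) + 2, v)"
    using step_nth[of prog pre] by auto
  then show ?case by (intro exI[of _ 1]) (simp add: ac_simps)
next
  case (exec_Loop_Suc v r n c u w)
  have 1: "(step prog ^^ 1) (p, v) = (Suc p, v(r := n))"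
    using exec_Loop_Suc.prems exec_Loop_Suc.hyps(1) step_nth[of prog pre] by auto
  let ?l = "length (code c (Suc p))"
  have "\<exists>m. (step prog ^^ m) (Suc p, v(r := n)) = (Suc p + ?l, u)"
    by (rule exec_Loop_Suc.IH(1)[of "pre @ [IJzd r (p + ?l + 2) (Suc p)]" "Suc p"
        "ICopy 0 0 p # post"]) (use exec_Loop_Suc.prems in simp_all)
  then obtain m where 2: "(step prog ^^ m) (Suc p, v(r := n)) = (Suc p + ?l, u)" ..
  have 3: "(step prog ^^ 1) (Suc p + ?l, u) = (p, u)"
    using exec_Loop_Suc.prems
      step_nth[of prog "pre @ IJzd r (p + ?l + 2) (Suc p) # code c (Suc p)" "ICopy 0 0 p" post
        "Suc p + ?l" u] by simp
  obtain k where 4: "(step prog ^^ k) (p, u) = (p + length (code (Loop r c) p), w)"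
    using exec_Loop_Suc.IH(2)[OF exec_Loop_Suc.prems] by blast
  obtain i where "(step prog ^^ i) (p, v) = (Suc p + ?l, u)" using funpow_trans[OF 1 2] ..
  then obtain j where "(step prog ^^ j) (p, v) = (p, u)" using funpow_trans[OF _ 3] by blast
  from funpow_trans[OF this 4] show ?case .
next
  case (exec_Clear r v)
  then show ?case using step_nth[of prog pre] by (intro exI[of _ 1]) auto
next
  case (exec_Copy r s v)
  then show ?case using step_nth[of prog pre] by (intro exI[of _ 1]) auto
next
  case (exec_Inc r v)
  then show ?case using step_nth[of prog pre] by (intro exI[of _ 1]) auto
qed

definition halts_on :: "instr list \<Rightarrow> (nat \<Rightarrow> nat) \<Rightarrow> bool" where
  "halts_on prog v \<longleftrightarrow> (\<exists>n. halted prog ((step prog ^^ n) (0, v)))"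

lemma halted_funpow: "halted prog c \<Longrightarrow> (step prog ^^ n) c = c"
  by (induction n) (auto simp: step_def)

text \<open>Only terminating computations of \<open>F\<close> matter, so the compiler need not be shown to preserve
  divergence: the program diverges on a positive result by an explicit endless loop.\<close>

lemma halting_program:
  "\<exists>prog. \<forall>v. (computes F (map v [0..<n]) 0 \<longrightarrow> halts_on prog v)
     \<and> (\<forall>y. computes F (map v [0..<n]) (Suc y) \<longrightarrow> \<not> halts_on prog v)"
proof -
  define c where "c = compile F [0..<n] n (Suc n)"
  define prog where "prog = code (Seq c (Loop n (Inc n))) 0"
  define q where "q = length (code c 0)"
  have prog: "prog = [] @ code c 0 @ [IJzd n (q + 3) (Suc q), IInc n (q + 2), ICopy 0 0 q]"
    by (simp add: prog_def q_def)
  have run: "\<exists>m w. (step prog ^^ m) (0, v) = (q, w) \<and> w n = y"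
    if F: "computes F (map v [0..<n]) y" for v y
  proof -
    have "{0..<n} \<subseteq> {..<Suc n}" by auto
    then obtain w where w: "exec c v w" "agree (Suc n) w (v(n := y))"
      using implementsD[OF compile_correct, of F v "[0..<n]" y "Suc n" n] F
      unfolding c_def by auto
    obtain m where "(step prog ^^ m) (0, v) = (q, w)"
      using exec_code[OF w(1) prog] by (auto simp: q_def)
    moreover have "w n = y" using w(2) by (simp add: agree_def)
    ultimately show ?thesis by blast
  qed
  have s: "step prog (q, w) = (if w n = 0 then (q + 3, w) else (Suc q, w(n := w n - 1)))"
     "step prog (Suc q, w) = (q + 2, w(n := Suc (w n)))" "step prog (Suc (Suc q), w) = (q, w)" for w
    using step_nth[OF prog[simplified], of q w]
      step_nth[of prog "code c 0 @ [IJzd n (q + 3) (Suc q)]" "IInc n (q + 2)" "[ICopy 0 0 q]"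
        "Suc q" w]
      step_nth[of prog "code c 0 @ [IJzd n (q + 3) (Suc q), IInc n (q + 2)]" "ICopy 0 0 q" "[]"
        "Suc (Suc q)" w]
    by (auto simp: prog q_def)
  show ?thesis
  proof (intro exI[of _ prog] allI conjI impI)
    fix v assume "computes F (map v [0..<n]) 0"
    then obtain m w where "(step prog ^^ m) (0, v) = (q, w)" "w n = 0" using run by blast
    then have "(step prog ^^ Suc m) (0, v) = (q + 3, w)" by (simp add: s)
    moreover have "halted prog (q + 3, w)" by (simp add: halted_def prog q_def)
    ultimately show "halts_on prog v" unfolding halts_on_def by metis
  next
    fix v y assume "computes F (map v [0..<n]) (Suc y)"
    then obtain m w where m: "(step prog ^^ m) (0, v) = (q, w)" "w n = Suc y" using run by blast
    \<comment> \<open>The three instructions decrement the positive register \<open>n\<close>,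
      restore it and jump back.\<close>
    have "(step prog ^^ 3) (q, w) = (q, w)"
      using m(2) by (simp add: numeral_3_eq_3 s fun_upd_idem)
    then have cyc: "(step prog ^^ (3 * j)) (q, w) = (q, w)" for j
      by (induction j) (simp_all add: funpow_add)
    show "\<not> halts_on prog v"
    proof
      assume "halts_on prog v"
      then obtain j where j: "halted prog ((step prog ^^ j) (0, v))" by (auto simp: halts_on_def)
      \<comment> \<open>A visit to \<open>q\<close> no earlier than time \<open>j\<close>. Halted
        configurations are fixed points, so the one at time \<open>j\<close> would be at
        \<open>q\<close> as well, which is an address inside the program.\<close>
      have "(step prog ^^ (3 * j + m)) (0, v) = (q, w)" by (simp add: funpow_add m cyc)
      moreover have "3 * j + m = (2 * j + m) + j" by simp
      ultimately have "(step prog ^^ (2 * j + m)) ((step prog ^^ j) (0, v)) = (q, w)"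
        by (simp only: funpow_add comp_apply)
      then have "(step prog ^^ j) (0, v) = (q, w)" using halted_funpow[OF j] by simp
      then show False using j by (simp add: halted_def prog q_def)
    qed
  qed
qed


section \<open>Zones from lists of inequalities\<close>

type_synonym ineq = "(int \<times> nat) list \<times> int"

definition lin :: "(int \<times> nat) list \<Rightarrow> (nat \<Rightarrow> real) \<Rightarrow> real" where
  "lin ts p = (\<Sum>(c, l)\<leftarrow>ts. of_int c * p l)"

definition holds :: "ineq list \<Rightarrow> (nat \<Rightarrow> real) \<Rightarrow> bool" where
  "holds cs p \<longleftrightarrow> (\<forall>c\<in>set cs. lin (fst c) p \<le> of_int (snd c))"

definition uses_below :: "nat \<Rightarrow> ineq list \<Rightarrow> bool" where
  "uses_below d cs \<longleftrightarrow> (\<forall>c\<in>set cs. \<forall>t\<in>set (fst c). snd t < d)"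

definition zone_of :: "nat \<Rightarrow> ineq list \<Rightarrow> zone" where
  "zone_of d cs =
    (mat (length cs) d (\<lambda>(i, j). \<Sum>(c, l)\<leftarrow>fst (cs ! i). if l = j then c else 0),
     vec (length cs) (\<lambda>i. snd (cs ! i)))"

lemma lin_simps [simp]:
  "lin [] p = 0" "lin ((c, l) # ts) p = of_int c * p l + lin ts p"
  by (simp_all add: lin_def)

lemma holds_simps [simp]:
  "holds [] p" "holds (c # cs) p \<longleftrightarrow> lin (fst c) p \<le> of_int (snd c) \<and> holds cs p"
  "holds (cs @ ds) p \<longleftrightarrow> holds cs p \<and> holds ds p"
  "holds (concat css) p \<longleftrightarrow> (\<forall>cs\<in>set css. holds cs p)"
  "holds (map f xs) p \<longleftrightarrow> (\<forall>x\<in>set xs. lin (fst (f x)) p \<le> of_int (snd (f x)))"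
  by (auto simp: holds_def)

lemma uses_below_simps [simp]:
  "uses_below d []"
  "uses_below d (c # cs) \<longleftrightarrow> (\<forall>t\<in>set (fst c). snd t < d) \<and> uses_below d cs"
  "uses_below d (cs @ ds) \<longleftrightarrow> uses_below d cs \<and> uses_below d ds"
  "uses_below d (concat css) \<longleftrightarrow> (\<forall>cs\<in>set css. uses_below d cs)"
  by (auto simp: uses_below_def)

lemma holds_cong:
  assumes "uses_below d cs" "\<And>l. l < d \<Longrightarrow> p l = q l"
  shows "holds cs p \<longleftrightarrow> holds cs q"
proof -
  have "lin ts p = lin ts q" if "\<forall>t\<in>set ts. snd t < d" for ts
    using that by (induction ts) (auto simp: assms(2))
  then show ?thesis using assms(1) by (simp add: holds_def uses_below_def)
qed

lemma sum_coefficients: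
  assumes "\<forall>t\<in>set ts. snd t < d"
  shows "(\<Sum>j<d. of_int (\<Sum>(c, l)\<leftarrow>ts. if l = j then c else 0) * p j) = lin ts p"
  using assms
proof (induction ts)
  case (Cons t ts)
  obtain c l where t: "t = (c, l)" "l < d" using Cons.prems by (cases t) auto
  have "(\<Sum>j<d. of_int (if l = j then c else 0) * p j) = (\<Sum>j<d. if j = l then of_int c * p l else 0)"
    by (rule sum.cong) auto
  also have "\<dots> = of_int c * p l" using t(2) by simp
  finally show ?case using Cons t by (simp add: distrib_right sum.distrib)
qed simp

lemma is_zone_zone_of: "is_zone d (zone_of d cs)"
  by (simp add: is_zone_def zone_of_def)

lemma zone_set_zone_of:
  assumes "uses_below d cs"
  shows "zone_set (zone_of d cs) = {x \<in> carrier_vec d. holds cs (($) x)}"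
proof -
  have "row (map_mat real_of_int (fst (zone_of d cs))) i \<bullet> x = lin (fst (cs ! i)) (($) x)"
    if "x \<in> carrier_vec d" "i < length cs" for x i
  proof -
    have "\<forall>t\<in>set (fst (cs ! i)). snd t < d"
      using assms that(2) nth_mem unfolding uses_below_def by blast
    from sum_coefficients[OF this, of "($) x"] show ?thesis
      using that by (simp add: zone_of_def scalar_prod_def atLeast0LessThan)
  qed
  then show ?thesis
    by (auto simp: zone_set_def less_eq_vec_def holds_def all_set_conv_all_nth zone_of_def)
qed


section \<open>Executions of non-Zeno schedules\<close>

lemma time_Suc: "time \<pi> (Suc j) = time \<pi> j + fst (\<pi> j)"
  by (simp add: time_def)

lemma time_mono:
  assumes "is_schedule M \<pi>" "i \<le> j"
  shows "time \<pi> i \<le> time \<pi> j"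
  using assms(1) unfolding time_def is_schedule_def
  by (intro sum_mono2) (auto simp: assms(2) less_imp_le intro: less_le_trans)

lemma non_zeno_segment:
  assumes "non_zeno \<pi>" "0 \<le> \<tau>"
  obtains j where "time \<pi> j \<le> \<tau>" "\<tau> \<le> time \<pi> (Suc j)"
proof -
  have "\<exists>n. \<tau> < time \<pi> n"
    using assms(1) unfolding non_zeno_def filterlim_at_top_dense
    by (meson eventually_happens sequentially_bot)
  define n where "n = (LEAST n. \<tau> < time \<pi> n)"
  have n: "\<tau> < time \<pi> n" using \<open>\<exists>n. _\<close> unfolding n_def by (rule LeastI_ex)
  then obtain j where j: "n = Suc j" using assms(2) by (cases n) (auto simp: time_def)
  then have "\<not> \<tau> < time \<pi> j" using not_less_Least[of j "\<lambda>n. \<tau> < time \<pi> n"] n_def by simp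
  then show thesis using that[of j] n j by simp
qed

lemma point_carrier:
  assumes "is_schedule M \<pi>" "M \<subseteq> carrier_vec d" "x \<in> carrier_vec d"
  shows "point x \<pi> j \<in> carrier_vec d"
  using assms by (induction j) (auto simp: is_schedule_def subset_iff)

lemma induces_segment:
  assumes "is_schedule M \<pi>" "M \<subseteq> carrier_vec d" "x \<in> carrier_vec d" "induces x \<pi> \<sigma>"
    and "time \<pi> j \<le> \<tau>" "\<tau> \<le> time \<pi> (Suc j)"
  shows "\<sigma> \<tau> = point x \<pi> j + (\<tau> - time \<pi> j) \<cdot>\<^sub>v snd (\<pi> j)"
proof -
  have m: "snd (\<pi> j) \<in> carrier_vec d" "fst (\<pi> j) > 0"
    using assms(1,2) by (auto simp: is_schedule_def)
  note p = point_carrier[OF assms(1-3)]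
  have "point x \<pi> (Suc j) - point x \<pi> j = fst (\<pi> j) \<cdot>\<^sub>v snd (\<pi> j)"
    using m(1) p[of j] by (auto intro!: eq_vecI)
  then show ?thesis
    using assms(4-6) m(2) unfolding induces_def
    by (auto simp: time_Suc smult_smult_assoc)
qed

text \<open>\<open>induces\<close> constrains a breakpoint through both adjacent segments. Choosing
  the first segment for each time works because both formulas agree there and, the times being
  strictly increasing, no other segments meet.\<close>

lemma ex_induces:
  assumes "is_schedule M \<pi>" "M \<subseteq> carrier_vec d" "x \<in> carrier_vec d"
  shows "\<exists>\<sigma>. induces x \<pi> \<sigma>"
proof -
  define J where "J \<tau> = (LEAST j. \<tau> \<le> time \<pi> (Suc j))" for \<tau>
  define g where "g j \<tau> = point x \<pi> j
       + ((\<tau> - time \<pi> j) / (time \<pi> (Suc j) - time \<pi> j)) \<cdot>\<^sub>v (point x \<pi> (Suc j) - point x \<pi> j)" for j \<tau>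
  note p = point_carrier[OF assms]
  have pos: "fst (\<pi> j) > 0" for j using assms(1) by (simp add: is_schedule_def)
  have "g (J \<tau>) \<tau> = g j \<tau>" if "time \<pi> j \<le> \<tau>" "\<tau> \<le> time \<pi> (Suc j)" for j \<tau>
  proof -
    have J: "J \<tau> \<le> j" "\<tau> \<le> time \<pi> (Suc (J \<tau>))"
      unfolding J_def using that(2) by (auto intro: Least_le LeastI)
    show ?thesis
    proof (cases "J \<tau> = j")
      case False
      then have "time \<pi> (Suc (J \<tau>)) \<le> time \<pi> j" using J(1) by (intro time_mono[OF assms(1)]) simp
      then have eq: "\<tau> = time \<pi> (Suc (J \<tau>))" "\<tau> = time \<pi> j" using J that by auto
      have "Suc (J \<tau>) = j"
      proof (rule ccontr)
        assume "Suc (J \<tau>) \<noteq> j"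
        then have "time \<pi> (Suc (Suc (J \<tau>))) \<le> time \<pi> j"
          using J(1) False by (intro time_mono[OF assms(1)]) simp
        then show False using eq pos[of "Suc (J \<tau>)"] by (simp add: time_Suc)
      qed
      moreover have "g (J \<tau>) (time \<pi> (Suc (J \<tau>))) = point x \<pi> (Suc (J \<tau>))"
        using p[of "J \<tau>"] p[of "Suc (J \<tau>)"] pos[of "J \<tau>"]
        by (intro eq_vecI) (auto simp: g_def time_Suc simp del: point.simps)
      moreover have "g j (time \<pi> j) = point x \<pi> j"
        using p[of j] p[of "Suc j"] by (intro eq_vecI) (auto simp: g_def simp del: point.simps)
      ultimately show ?thesis using eq by simp
    qed simp
  qed
  then have "induces x \<pi> (\<lambda>\<tau>. g (J \<tau>) \<tau>)"
    unfolding induces_def g_def[symmetric] by simp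
  then show ?thesis by (rule exI[where x = "\<lambda>\<tau>. g (J \<tau>) \<tau>"])
qed


section \<open>Cyclic systems\<close>

text \<open>The first \<open>D\<close> coordinates carry data, the other \<open>N\<close> make the control point run along
  the edges of the cycle formed by the unit vectors. Traversing an edge takes one time unit.
  On edge \<open>i\<close>, either one data coordinate \<open>mv i\<close> is changed by an arbitrary amount, by mixing two
  modes, or the data remain fixed and have to satisfy one of the constraints \<open>alts i\<close>.\<close>

locale cycle =
  fixes D N :: nat and mv :: "nat \<Rightarrow> nat option" and alts :: "nat \<Rightarrow> ineq list list"
    and fin tgt :: "ineq list"
  assumes N_ge: "N \<ge> 4"
    and mv_less: "mv i = Some l \<Longrightarrow> l < D"
    and mv_alts: "mv i = Some l \<Longrightarrow> alts i = [[]]"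
    and mv_0: "mv 0 \<noteq> None"
    and alts_last: "alts (N - 1) = [fin]"
    and alts_below: "C \<in> set (alts i) \<Longrightarrow> uses_below D C"
    and tgt_below: "uses_below D tgt"
begin

section \<open>Zones, modes and formulas on the cycle\<close>

definition nx :: "nat \<Rightarrow> nat" where
  "nx i = (if Suc i = N then 0 else Suc i)"

definition pos :: "nat \<Rightarrow> real \<Rightarrow> nat \<Rightarrow> real" where
  "pos i u l = (if l = i then 1 - u else if l = nx i then u else 0)"

text \<open>The control coordinates are confined to the segment between two unit vectors and the
  data to a box, so the zone is bounded whatever \<open>C\<close> is.\<close>

definition edge_ineqs :: "nat \<Rightarrow> ineq list \<Rightarrow> ineq list" where
  "edge_ineqs i C =
     concat (map (\<lambda>l. [([(1, l)], 3), ([(-1, l)], 2)]) [0..<D])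
     @ concat (map (\<lambda>l. [([(-1, D + l)], 0)]) [0..<N])
     @ concat (map (\<lambda>l. [([(1, D + l)], 0)]) (filter (\<lambda>l. l \<noteq> i \<and> l \<noteq> nx i) [0..<N]))
     @ [([(1, D + i), (1, D + nx i)], 1), ([(-1, D + i), (-1, D + nx i)], -1)] @ C"

definition edge_zone :: "nat \<Rightarrow> ineq list \<Rightarrow> zone" where
  "edge_zone i C = zone_of (D + N) (edge_ineqs i C)"

definition edge_zones :: "nat \<Rightarrow> zone list" where
  "edge_zones i = map (edge_zone i) (alts i)"

text \<open>The first inequality places the control point at vertex 0, where rounds begin and
  end.\<close>

definition target :: zone where
  "target = zone_of (D + N) (([(-1, D)], -1) # edge_ineqs 0 tgt)"

text \<open>A coordinate is moved by \<open>\<delta>\<close>, where \<open>\<bar>\<delta>\<bar> \<le> 1\<close>, by moving it up for the time \<open>(2 + \<delta>) / 4\<close> and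
  then down for the rest of the time unit. Both durations are positive, as required for
  schedules, and starting in \<open>[0, 1]\<close> the coordinate stays in the interval \<open>[- 2, 3]\<close>.\<close>

definition mode :: "nat \<Rightarrow> 'a::field_char_0 \<Rightarrow> 'a vec" where
  "mode i s = vec (D + N) (\<lambda>l. if l < D then (if mv i = Some l then 2 * s else 0)
     else if l = D + i then - 1 else if l = D + nx i then 1 else 0)"

definition rat_modes :: "rat vec list" where
  "rat_modes = concat (map (\<lambda>i. [mode i 1, mode i (- 1)]) [0..<N])"

definition Modes :: "real vec set" where
  "Modes = map_vec real_of_rat ` set rat_modes"

definition chain :: "ltl \<Rightarrow> zone list \<Rightarrow> ltl" where
  "chain \<phi> Zs = foldr (\<lambda>Z. Until (Atom Z)) Zs \<phi>"

definition either :: "ltl \<Rightarrow> zone list \<Rightarrow> ltl" where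
  "either \<phi> Zs = foldr (\<lambda>Z. Disj (Atom Z)) Zs \<phi>"

definition inner_zones :: "zone list" where
  "inner_zones = concat (map edge_zones [0..<N - 1])"

definition reach_formula :: ltl where
  "reach_formula = Until (chain (Atom (edge_zone (N - 1) fin)) inner_zones) (Atom target)"

definition safe_formula :: ltl where
  "safe_formula = Globally (either (Atom (edge_zone (N - 1) fin)) inner_zones)"

definition inside :: "real vec \<Rightarrow> bool" where
  "inside x \<longleftrightarrow> (\<exists>i<N. \<exists>Z\<in>set (edge_zones i). x \<in> zone_set Z)"

definition initial :: "(nat \<Rightarrow> real) \<Rightarrow> real vec \<Rightarrow> bool" where
  "initial z x \<longleftrightarrow> x \<in> carrier_vec (D + N) \<and> (\<forall>l<D. x $ l = z l) \<and> (\<forall>l<N. x $ (D + l) = pos 0 0 l)"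

text \<open>The discrete shadow of an execution, sampled at the vertices. The coordinate moved on an
  edge receives an arbitrary new value, which is the nondeterministic guess.\<close>

inductive reach :: "(nat \<Rightarrow> real) \<Rightarrow> nat \<Rightarrow> (nat \<Rightarrow> real) \<Rightarrow> bool" for z0 where
  reach_0: "(\<And>l. l < D \<Longrightarrow> z l = z0 l) \<Longrightarrow> reach z0 0 z"
| reach_Suc: "reach z0 e z
    \<Longrightarrow> (\<And>l. l < D \<Longrightarrow> mv (e mod N) \<noteq> Some l \<Longrightarrow> z' l = z l)
    \<Longrightarrow> (mv (e mod N) = None \<Longrightarrow> \<exists>C\<in>set (alts (e mod N)). holds C z)
    \<Longrightarrow> reach z0 (Suc e) z'"

lemma nx_mod: "nx (e mod N) = Suc e mod N"
  by (simp add: nx_def mod_Suc)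

lemma nx_less: "i < N \<Longrightarrow> nx i < N"
  by (auto simp: nx_def)

lemma nx_neq:
  assumes "i < N"
  shows "nx i \<noteq> i" "nx (nx i) \<noteq> i" "nx (nx i) \<noteq> nx i" "nx (nx (nx i)) \<noteq> i"
  using assms N_ge by (auto simp: nx_def)

lemma holds_edge_ineqs:
  assumes "i < N"
  shows "holds (edge_ineqs i C) p \<longleftrightarrow> (\<forall>l<D. - 2 \<le> p l \<and> p l \<le> 3) \<and> (\<forall>l<N. 0 \<le> p (D + l))
    \<and> (\<forall>l<N. l \<noteq> i \<longrightarrow> l \<noteq> nx i \<longrightarrow> p (D + l) = 0) \<and> p (D + i) + p (D + nx i) = 1 \<and> holds C p"
proof -
  have box: "holds (concat (map (\<lambda>l. [([(1, l)], 3), ([(-1, l)], 2)]) [0..<D])) p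
      \<longleftrightarrow> (\<forall>l<D. - 2 \<le> p l \<and> p l \<le> 3)"
    by (auto simp: minus_le_iff)
  have nonneg: "holds (concat (map (\<lambda>l. [([(-1, D + l)], 0)]) [0..<N])) p
      \<longleftrightarrow> (\<forall>l<N. 0 \<le> p (D + l))" by auto
  have zero: "holds (concat (map (\<lambda>l. [([(1, D + l)], 0)])
        (filter (\<lambda>l. l \<noteq> i \<and> l \<noteq> nx i) [0..<N]))) p
      \<longleftrightarrow> (\<forall>l<N. l \<noteq> i \<longrightarrow> l \<noteq> nx i \<longrightarrow> p (D + l) \<le> 0)" by auto
  have sum: "holds [([(1, D + i), (1, D + nx i)], 1), ([(-1, D + i), (-1, D + nx i)], -1)] p
      \<longleftrightarrow> p (D + i) + p (D + nx i) = 1" by auto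
  show ?thesis
    unfolding edge_ineqs_def holds_simps(3) box nonneg zero sum
    by (auto intro: order_antisym)
qed

lemma uses_below_edge_ineqs:
  "i < N \<Longrightarrow> uses_below D C \<Longrightarrow> uses_below (D + N) (edge_ineqs i C)"
  using nx_less[of i] unfolding edge_ineqs_def by (fastforce simp: uses_below_def)

lemma edge_zone_iff:
  assumes "i < N" "uses_below D C"
  shows "x \<in> zone_set (edge_zone i C) \<longleftrightarrow> x \<in> carrier_vec (D + N) \<and> holds (edge_ineqs i C) (($) x)"
  using zone_set_zone_of[OF uses_below_edge_ineqs[OF assms]] by (simp add: edge_zone_def)

lemma target_iff:
  "x \<in> zone_set target \<longleftrightarrow> x \<in> carrier_vec (D + N) \<and> 1 \<le> x $ D \<and> holds (edge_ineqs 0 tgt) (($) x)"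
  using zone_set_zone_of[of "D + N" "([(-1, D)], -1) # edge_ineqs 0 tgt"] N_ge
    uses_below_edge_ineqs[OF _ tgt_below, of 0] by (auto simp: target_def)

lemma inside_iff:
  "inside x \<longleftrightarrow> x \<in> carrier_vec (D + N)
    \<and> (\<exists>i<N. \<exists>C\<in>set (alts i). holds (edge_ineqs i C) (($) x))"
  unfolding inside_def edge_zones_def using edge_zone_iff alts_below by fastforce

lemma bounded_if_edge_ineqs:
  assumes "i < N" "\<And>x. x \<in> zone_set Z \<Longrightarrow> x \<in> carrier_vec (D + N) \<and> holds (edge_ineqs i C) (($) x)"
  shows "bounded_zone Z"
  unfolding bounded_zone_def
proof (intro exI ballI allI impI)
  fix x l assume x: "x \<in> zone_set Z" "l < dim_vec x"
  have h: "\<forall>l<D. - 2 \<le> x $ l \<and> x $ l \<le> 3" "\<forall>l<N. 0 \<le> x $ (D + l)"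
    "\<forall>l<N. l \<noteq> i \<longrightarrow> l \<noteq> nx i \<longrightarrow> x $ (D + l) = 0" "x $ (D + i) + x $ (D + nx i) = 1"
    using assms(2)[OF x(1)] unfolding holds_edge_ineqs[OF assms(1)] by auto
  show "\<bar>x $ l\<bar> \<le> 3"
  proof (cases "l < D")
    case False
    then obtain k where k: "l = D + k" "k < N"
      using x assms(2)[OF x(1)] by (metis add_less_cancel_left carrier_vecD le_Suc_ex not_less)
    have "x $ (D + i) \<ge> 0" "x $ (D + nx i) \<ge> 0" using h(2) assms(1) nx_less by auto
    then show ?thesis using h(2,3,4) k by (cases "k = i \<or> k = nx i") auto
  qed (use h(1) in fastforce)
qed

lemma index_mode:
  "l < D \<Longrightarrow> mode i s $ l = (if mv i = Some l then 2 * s else 0)"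
  "l < N \<Longrightarrow> mode i s $ (D + l) = (if l = i then - 1 else if l = nx i then 1 else 0)"
  by (simp_all add: mode_def)

lemma mode_carrier: "mode i s \<in> carrier_vec (D + N)"
  by (simp add: mode_def)

lemma Modes_eq: "Modes = {mode i s | i s. i < N \<and> (s = 1 \<or> s = - 1)}"
proof -
  have "map_vec real_of_rat (mode i s) = mode i (of_rat s)" for i s
    by (auto simp: mode_def of_rat_mult)
  then show ?thesis by (force simp: Modes_def rat_modes_def image_UN of_rat_minus)
qed

lemma Modes_carrier: "Modes \<subseteq> carrier_vec (D + N)"
  by (auto simp: Modes_eq mode_carrier)

lemma mms_Modes: "mms (D + N) Modes"
  using Modes_carrier N_ge by (simp add: mms_def Modes_def)


subsection \<open>Executions follow the cycle\<close>

text \<open>The invariant of executions inside the zones: \<open>e\<close> edges are completed, and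
  the fraction \<open>u\<close> of the next one. \<open>z\<close> holds the data at the last vertex;
  strictly inside an edge the moving coordinate may have any value.\<close>

definition tracked :: "(nat \<Rightarrow> real) \<Rightarrow> real \<Rightarrow> real vec \<Rightarrow> bool" where
  "tracked z0 \<tau> x \<longleftrightarrow> (\<exists>e z u. \<tau> = real e + u \<and> 0 \<le> u \<and> u < 1 \<and> reach z0 e z
     \<and> (\<forall>l<N. x $ (D + l) = pos (e mod N) u l)
     \<and> (\<forall>l<D. u = 0 \<or> mv (e mod N) \<noteq> Some l \<longrightarrow> x $ l = z l)
     \<and> (u > 0 \<longrightarrow> mv (e mod N) = None \<longrightarrow> (\<exists>C\<in>set (alts (e mod N)). holds C z)))"

text \<open>The mode cannot belong to another edge; it cannot overrun the end of the current edge,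
  because control coordinate \<open>i\<close> would become negative; and it cannot avoid the check,
  which is read off at an interior point.\<close>

lemma tracked_step:
  assumes tr: "tracked z0 \<tau> x" and x: "x \<in> carrier_vec (D + N)" and m: "m = mode k s" "k < N"
    and \<delta>: "0 < \<delta>" and ins: "\<And>\<epsilon>. 0 < \<epsilon> \<Longrightarrow> \<epsilon> \<le> \<delta> \<Longrightarrow> inside (x + \<epsilon> \<cdot>\<^sub>v m)"
  shows "tracked z0 (\<tau> + \<delta>) (x + \<delta> \<cdot>\<^sub>v m)"
proof -
  obtain e z u where \<tau>: "\<tau> = real e + u" and u: "0 \<le> u" "u < 1" and z: "reach z0 e z"
    and at: "\<forall>l<N. x $ (D + l) = pos (e mod N) u l"
      "\<forall>l<D. u = 0 \<or> mv (e mod N) \<noteq> Some l \<longrightarrow> x $ l = z l"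
      "u > 0 \<longrightarrow> mv (e mod N) = None \<longrightarrow> (\<exists>C\<in>set (alts (e mod N)). holds C z)"
    using tr unfolding tracked_def by (elim exE conjE) (rule that, assumption+)
  note ctrl = at(1)[rule_format] and data = at(2)[rule_format] and chk = at(3)[rule_format]
  define i where "i = e mod N"
  have i: "i < N" "nx i < N" "nx (nx i) < N" using N_ge nx_less by (auto simp: i_def)
  have comp: "(x + \<epsilon> \<cdot>\<^sub>v m) $ l = x $ l + \<epsilon> * m $ l" if "l < D + N" for \<epsilon> l
    using x that by (simp add: m mode_def)
  have zone: "\<exists>j<N. \<exists>C\<in>set (alts j). (\<forall>l<N. 0 \<le> (x + \<epsilon> \<cdot>\<^sub>v m) $ (D + l))
      \<and> (\<forall>l<N. l \<noteq> j \<longrightarrow> l \<noteq> nx j \<longrightarrow> (x + \<epsilon> \<cdot>\<^sub>v m) $ (D + l) = 0) \<and> holds C (($) (x + \<epsilon> \<cdot>\<^sub>v m))"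
    if "0 < \<epsilon>" "\<epsilon> \<le> \<delta>" for \<epsilon>
    using ins[OF that] unfolding inside_iff by (metis holds_edge_ineqs)
  have nonneg: "0 \<le> (x + \<epsilon> \<cdot>\<^sub>v m) $ (D + l)" if "0 < \<epsilon>" "\<epsilon> \<le> \<delta>" "l < N" for \<epsilon> l
    using zone[OF that(1,2)] that(3) by blast
  have m_ctrl: "m $ (D + l) = (if l = k then - 1 else if l = nx k then 1 else 0)" if "l < N" for l
    using that by (simp add: m index_mode)
  have "k = i"
  proof (rule ccontr)
    assume ki: "k \<noteq> i"
    \<comment> \<open>A mode of edge \<open>k\<close> drains control coordinate \<open>k\<close>, so
      \<open>k\<close> is an end of edge \<open>i\<close>. Draining \<open>nx i\<close> would feed
      \<open>nx (nx i)\<close> while \<open>i\<close> is still positive, and in a cycle of length at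
      least 4 no edge contains both.\<close>
    have "pos i u k \<ge> \<delta>"
      using nonneg[of \<delta> k] \<delta> m(2) comp[of "D + k" \<delta>] ctrl[of k] m_ctrl[of k] by (simp add: i_def)
    then have k: "k = nx i" using \<delta> ki by (auto simp: pos_def split: if_splits)
    have "(x + \<delta> \<cdot>\<^sub>v m) $ (D + i) > 0" "(x + \<delta> \<cdot>\<^sub>v m) $ (D + nx (nx i)) > 0"
      using comp[of "D + i" \<delta>] comp[of "D + nx (nx i)" \<delta>] ctrl[of i] ctrl[of "nx (nx i)"]
        m_ctrl[of i] m_ctrl[of "nx (nx i)"] i nx_neq[OF i(1)] k u \<delta>
      by (simp_all add: pos_def i_def[symmetric])
    moreover obtain j where j: "j < N"
      "\<And>l. l < N \<Longrightarrow> l \<noteq> j \<Longrightarrow> l \<noteq> nx j \<Longrightarrow> (x + \<delta> \<cdot>\<^sub>v m) $ (D + l) = 0"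
      using zone[of \<delta>] \<delta> by blast
    ultimately have "i = j \<or> i = nx j" "nx (nx i) = j \<or> nx (nx i) = nx j"
      using j(2)[OF i(1)] j(2)[OF i(3)] by fastforce+
    then show False using nx_neq[OF i(1)] nx_neq[OF j(1)] by auto
  qed
  have ctrl': "(x + \<epsilon> \<cdot>\<^sub>v m) $ (D + l) = pos i (u + \<epsilon>) l" if "l < N" for \<epsilon> l
    using comp[of "D + l" \<epsilon>] ctrl[OF that] m_ctrl[OF that] that nx_neq[OF i(1)] \<open>k = i\<close>
    by (simp add: pos_def i_def[symmetric])
  have data': "(x + \<epsilon> \<cdot>\<^sub>v m) $ l = z l" if "l < D" "mv i \<noteq> Some l" for \<epsilon> l
    using comp[of l \<epsilon>] data[of l] that \<open>k = i\<close> by (simp add: m index_mode i_def)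
  have chk': "\<exists>C\<in>set (alts i). holds C z" if \<epsilon>: "0 < \<epsilon>" "\<epsilon> \<le> \<delta>" "u + \<epsilon> < 1" and "mv i = None" for \<epsilon>
  proof -
    obtain j C where j: "j < N" "C \<in> set (alts j)" "holds C (($) (x + \<epsilon> \<cdot>\<^sub>v m))"
      "\<And>l. l < N \<Longrightarrow> l \<noteq> j \<Longrightarrow> l \<noteq> nx j \<Longrightarrow> (x + \<epsilon> \<cdot>\<^sub>v m) $ (D + l) = 0"
      using zone[OF \<epsilon>(1,2)] by blast
    have "(x + \<epsilon> \<cdot>\<^sub>v m) $ (D + i) \<noteq> 0" "(x + \<epsilon> \<cdot>\<^sub>v m) $ (D + nx i) \<noteq> 0"
      using ctrl'[of i \<epsilon>] ctrl'[of "nx i" \<epsilon>] i \<epsilon> u nx_neq[OF i(1)] by (simp_all add: pos_def)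
    \<comment> \<open>At an interior point both ends of edge \<open>i\<close> have nonzero weight,
      which singles out this edge.\<close>
    then have "j = i" using j(4)[of i] j(4)[of "nx i"] i nx_neq[OF i(1)] nx_neq[OF j(1)] by metis
    moreover have "holds C z"
      using j(3) holds_cong[OF alts_below[OF j(2)], of "($) (x + \<epsilon> \<cdot>\<^sub>v m)" z] data' that(4) by simp
    ultimately show ?thesis using j(2) by blast
  qed
  have "u + \<delta> \<le> 1" using nonneg[of \<delta> i] ctrl'[of i \<delta>] \<delta> i by (simp add: pos_def)
  then consider "u + \<delta> < 1" | "u + \<delta> = 1" by linarith
  then show ?thesis
  proof cases
    case 1
    then show ?thesis unfolding tracked_def using z ctrl' data' chk'[of \<delta>] u \<delta> \<tau>
      by (intro exI[of _ e] exI[of _ z] exI[of _ "u + \<delta>"]) (auto simp: i_def)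
  next
    case 2
    \<comment> \<open>At the vertex itself the zone may belong to the next edge; half of the move
      still ends inside edge \<open>i\<close>.\<close>
    have "reach z0 (Suc e) (($) (x + \<delta> \<cdot>\<^sub>v m))"
      using z data' chk'[of "\<delta> / 2"] \<delta> 2 by (intro reach_Suc[OF z]) (auto simp: i_def)
    moreover have "pos i 1 l = pos (Suc e mod N) 0 l" for l
      using nx_neq[OF i(1)] by (simp add: pos_def nx_mod[symmetric] i_def)
    ultimately show ?thesis unfolding tracked_def using \<tau> 2 ctrl'
      by (intro exI[of _ "Suc e"] exI[of _ "($) (x + \<delta> \<cdot>\<^sub>v m)"] exI[of _ 0]) auto
  qed
qed

lemma tracked_execution:
  assumes sched: "is_schedule Modes \<pi>" "non_zeno \<pi>" "induces x \<pi> \<sigma>" and init: "initial z0 x"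
    and ins: "\<And>\<tau>. 0 \<le> \<tau> \<Longrightarrow> \<tau> \<le> T \<Longrightarrow> inside (\<sigma> \<tau>)" and "0 \<le> T"
  shows "tracked z0 T (\<sigma> T)"
proof -
  have x: "x \<in> carrier_vec (D + N)" using init by (simp add: initial_def)
  note seg = induces_segment[OF sched(1) Modes_carrier x sched(3)]
  note pc = point_carrier[OF sched(1) Modes_carrier x]
  have pos: "0 < fst (\<pi> j)" for j using sched(1) by (simp add: is_schedule_def)
  have nonneg: "0 \<le> time \<pi> j" for j using time_mono[OF sched(1), of 0 j] by (simp add: time_def)
  have move: "tracked z0 (time \<pi> j + \<delta>) (point x \<pi> j + \<delta> \<cdot>\<^sub>v snd (\<pi> j))"
    if "tracked z0 (time \<pi> j) (point x \<pi> j)" "0 < \<delta>" "\<delta> \<le> fst (\<pi> j)" "time \<pi> j + \<delta> \<le> T" for j \<delta>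
  proof -
    obtain k s where k: "snd (\<pi> j) = mode k s" "k < N"
      using sched(1) unfolding is_schedule_def Modes_eq by blast
    show ?thesis
    proof (rule tracked_step[OF that(1) pc k that(2)])
      fix \<epsilon> assume "0 < \<epsilon>" "\<epsilon> \<le> \<delta>"
      then show "inside (point x \<pi> j + \<epsilon> \<cdot>\<^sub>v snd (\<pi> j))"
        using ins[of "time \<pi> j + \<epsilon>"] seg[of j "time \<pi> j + \<epsilon>"] that nonneg[of j]
        by (simp add: time_Suc)
    qed
  qed
  have at: "time \<pi> j \<le> T \<Longrightarrow> tracked z0 (time \<pi> j) (point x \<pi> j)" for j
  proof (induction j)
    case 0
    have "reach z0 0 z0" by (rule reach_0) simp
    then show ?case using init unfolding tracked_def initial_def
      by (intro exI[of _ 0] exI[of _ z0]) (auto simp: time_def)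
  next
    case (Suc j)
    then show ?case using move[of j "fst (\<pi> j)"] pos[of j] by (simp add: time_Suc)
  qed
  obtain j where j: "time \<pi> j \<le> T" "T \<le> time \<pi> (Suc j)"
    using non_zeno_segment[OF sched(2) \<open>0 \<le> T\<close>] .
  show ?thesis
  proof (cases "T = time \<pi> j")
    case True
    have "point x \<pi> j + 0 \<cdot>\<^sub>v snd (\<pi> j) = point x \<pi> j"
      using pc[of j] sched(1) Modes_carrier
      by (intro eq_vecI) (auto simp: is_schedule_def subset_iff dest!: spec[of _ j])
    then show ?thesis using at[OF j(1)] seg[OF j] True by simp
  next
    case False
    then show ?thesis using move[OF at[OF j(1)], of "T - time \<pi> j"] seg[OF j] j
      by (simp add: time_Suc)
  qed
qed

section \<open>Soundness of the two formulas\<close>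

lemma inside_iff_zones:
  "inside x \<longleftrightarrow> (\<exists>Z\<in>insert (edge_zone (N - 1) fin) (set inner_zones). x \<in> zone_set Z)"
proof -
  have "{..<N} = insert (N - 1) {..<N - 1}" using N_ge by auto
  then have "(\<Union>i<N. set (edge_zones i)) = insert (edge_zone (N - 1) fin) (set inner_zones)"
    using alts_last by (simp add: inner_zones_def edge_zones_def atLeast0LessThan)
  then show ?thesis unfolding inside_def by blast
qed

lemma sat_either: "sat \<sigma> \<tau> (either (Atom Z) Zs) \<longleftrightarrow> (\<exists>Y\<in>insert Z (set Zs). \<sigma> \<tau> \<in> zone_set Y)"
  unfolding either_def by (induction Zs) auto

text \<open>Either the outermost \<open>Until\<close> is discharged now, which leaves the rest of
  the chain, or its zone contains the current point.\<close>

lemma sat_chainD: "sat \<sigma> \<tau> (chain (Atom Z) Zs) \<Longrightarrow> \<exists>Y\<in>insert Z (set Zs). \<sigma> \<tau> \<in> zone_set Y"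
proof (induction Zs)
  case (Cons Y Zs)
  then obtain \<tau>' where "\<tau> \<le> \<tau>'" "sat \<sigma> \<tau>' (chain (Atom Z) Zs)" "\<forall>t\<in>{\<tau>..<\<tau>'}. \<sigma> t \<in> zone_set Y"
    by (auto simp: chain_def)
  then show ?case using Cons.IH by (cases "\<tau> = \<tau>'") auto
qed (simp add: chain_def)

text \<open>\<open>Until\<close> constrains the times before the target is met, whereas the tracking
  also needs the meeting time. Edge 0 moves a coordinate and hence carries the empty constraint, so
  its zone contains the target.\<close>

lemma inside_if_target: "x \<in> zone_set target \<Longrightarrow> inside x"
proof -
  assume "x \<in> zone_set target"
  then have "x \<in> carrier_vec (D + N)" "holds (edge_ineqs 0 []) (($) x)"
    using N_ge by (auto simp: target_iff holds_edge_ineqs)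
  moreover have "[] \<in> set (alts 0)" "0 < N" using mv_0 mv_alts N_ge by auto
  ultimately show "inside x" unfolding inside_iff by blast
qed

lemma safe_sound:
  assumes "models Modes x safe_formula" "initial z0 x"
  shows "\<exists>z. reach z0 e z"
proof -
  obtain \<pi> \<sigma> where s: "is_schedule Modes \<pi>" "non_zeno \<pi>" "induces x \<pi> \<sigma>" "sat \<sigma> 0 safe_formula"
    using assms(1) unfolding models_def by blast
  have "tracked z0 (real e) (\<sigma> (real e))"
    using s(4) by (intro tracked_execution[OF s(1-3) assms(2)])
      (auto simp: safe_formula_def sat_either inside_iff_zones)
  then obtain e' z u where "real e = real e' + u" "0 \<le> u" "u < 1" "reach z0 e' z"
    unfolding tracked_def by blast
  moreover from this have "e' = e" by linarith
  ultimately show ?thesis by blast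
qed

lemma reach_sound:
  assumes "models Modes x reach_formula" "initial z0 x"
  shows "\<exists>n z. reach z0 (n * N) z \<and> holds tgt z"
proof -
  obtain \<pi> \<sigma> where s: "is_schedule Modes \<pi>" "non_zeno \<pi>" "induces x \<pi> \<sigma>" "sat \<sigma> 0 reach_formula"
    using assms(1) unfolding models_def by blast
  obtain T where T: "0 \<le> T" "\<sigma> T \<in> zone_set target"
    and "\<forall>\<tau>\<in>{0..<T}. sat \<sigma> \<tau> (chain (Atom (edge_zone (N - 1) fin)) inner_zones)"
    using s(4) unfolding reach_formula_def by auto
  then have ins: "inside (\<sigma> \<tau>)" if "0 \<le> \<tau>" "\<tau> < T" for \<tau>
    using that unfolding inside_iff_zones by (intro sat_chainD) auto
  have "tracked z0 T (\<sigma> T)"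
  proof (rule tracked_execution[OF s(1-3) assms(2) _ T(1)])
    fix \<tau> assume "0 \<le> \<tau>" "\<tau> \<le> T"
    then show "inside (\<sigma> \<tau>)"
      using ins inside_if_target[OF T(2)] by (cases "\<tau> = T") auto
  qed
  then obtain e z u where u: "0 \<le> u" "u < 1" and z: "reach z0 e z"
    and ctrl: "\<forall>l<N. \<sigma> T $ (D + l) = pos (e mod N) u l"
    and data: "\<forall>l<D. u = 0 \<or> mv (e mod N) \<noteq> Some l \<longrightarrow> \<sigma> T $ l = z l"
    unfolding tracked_def by blast
  have t: "1 \<le> \<sigma> T $ D" "holds (edge_ineqs 0 tgt) (($) (\<sigma> T))" using T(2) by (auto simp: target_iff)
  \<comment> \<open>As \<open>u < 1\<close>, control coordinate 0 has the value 1 only at vertex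
    0.\<close>
  have "e mod N = 0 \<and> u = 0"
    using ctrl[rule_format, of 0] t(1) N_ge u by (auto simp: pos_def split: if_splits)
  moreover from this have "holds tgt z"
    using t(2) holds_cong[OF tgt_below, of "($) (\<sigma> T)" z] data N_ge by (simp add: holds_edge_ineqs)
  ultimately show ?thesis using z by (metis mod_0_imp_dvd dvd_def mult.commute)
qed


subsection \<open>Data sequences yield executions\<close>

definition follows :: "(nat \<Rightarrow> nat \<Rightarrow> real) \<Rightarrow> (real \<Rightarrow> real vec) \<Rightarrow> bool" where
  "follows z \<sigma> \<longleftrightarrow> (\<forall>e \<tau>. real e \<le> \<tau> \<longrightarrow> \<tau> \<le> real e + 1 \<longrightarrow> \<sigma> \<tau> \<in> carrier_vec (D + N)
     \<and> (\<forall>l<N. \<sigma> \<tau> $ (D + l) = pos (e mod N) (\<tau> - real e) l)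
     \<and> (\<forall>l<D. \<tau> = real e \<or> mv (e mod N) \<noteq> Some l \<longrightarrow> \<sigma> \<tau> $ l = z e l)
     \<and> (\<forall>l<D. - 2 \<le> \<sigma> \<tau> $ l \<and> \<sigma> \<tau> $ l \<le> 3))"

lemma execution_exists:
  assumes const: "\<And>e l. l < D \<Longrightarrow> mv (e mod N) \<noteq> Some l \<Longrightarrow> z (Suc e) l = z e l"
    and unit: "\<And>e l. l < D \<Longrightarrow> 0 \<le> z e l \<and> z e l \<le> 1" and init: "initial (z 0) x"
  shows "\<exists>\<pi> \<sigma>. is_schedule Modes \<pi> \<and> non_zeno \<pi> \<and> induces x \<pi> \<sigma> \<and> follows z \<sigma>"
proof -
  \<comment> \<open>Moving up for the time \<open>s e\<close> and down for \<open>1 - s e\<close>,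
    both at speed 2, has the net effect \<open>4 * s e - 2\<close>.\<close>
  define s where "s e = (2 + (case mv (e mod N) of None \<Rightarrow> 0 | Some l \<Rightarrow> z (Suc e) l - z e l)) / 4" for e
  have s: "1 / 4 \<le> s e \<and> s e \<le> 3 / 4" for e
  proof (cases "mv (e mod N)")
    case (Some l)
    then show ?thesis using unit[of l e] unit[of l "Suc e"] mv_less[OF Some] by (simp add: s_def)
  qed (simp add: s_def)
  \<comment> \<open>Two schedule entries per edge, so that entry \<open>2 * e\<close> begins at time
    \<open>e\<close>.\<close>
  define \<pi> where "\<pi> j = (let e = j div 2 in if even j then (s e, mode (e mod N) 1)
      else (1 - s e, mode (e mod N) (- 1 :: real)))" for j
  have \<pi>: "\<pi> (2 * e) = (s e, mode (e mod N) 1)" "\<pi> (Suc (2 * e)) = (1 - s e, mode (e mod N) (- 1))" for e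
    by (simp_all add: \<pi>_def)
  have iN: "e mod N < N" for e using N_ge by simp
  have sched: "is_schedule Modes \<pi>"
    unfolding is_schedule_def
  proof
    fix j
    have "mode (e mod N) 1 \<in> Modes" "mode (e mod N) (- 1) \<in> Modes" for e
      using iN by (auto simp: Modes_eq)
    then show "0 < fst (\<pi> j) \<and> snd (\<pi> j) \<in> Modes"
      using s[of "j div 2"] by (simp add: \<pi>_def Let_def)
  qed
  have t: "time \<pi> (2 * e) = real e" for e
    by (induction e) (simp_all add: time_Suc \<pi>, simp add: time_def)
  then have t': "time \<pi> (Suc (2 * e)) = real e + s e" for e by (simp add: time_Suc \<pi>)
  have x: "x \<in> carrier_vec (D + N)" using init by (simp add: initial_def)
  note pc = point_carrier[OF sched Modes_carrier x]
  have add: "(p + a \<cdot>\<^sub>v mode i r) $ l = p $ l + a * mode i r $ l"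
    if "l < D + N" "p \<in> carrier_vec (D + N)" for a i r l and p :: "real vec"
    using that by (simp add: mode_def)
  have P: "(\<forall>l<D. point x \<pi> (2 * e) $ l = z e l)
      \<and> (\<forall>l<N. point x \<pi> (2 * e) $ (D + l) = pos (e mod N) 0 l)" for e
  proof (induction e)
    case 0
    then show ?case using init by (simp add: initial_def)
  next
    case (Suc e)
    have eq: "point x \<pi> (2 * Suc e) $ l = point x \<pi> (2 * e) $ l
        + s e * mode (e mod N) 1 $ l + (1 - s e) * mode (e mod N) (- 1) $ l" if "l < D + N" for l
      using pc[of "2 * e"] pc[of "Suc (2 * e)"] that by (simp add: \<pi> add)
    have "point x \<pi> (2 * Suc e) $ l = z (Suc e) l" if "l < D" for l
      unfolding eq[OF trans_less_add1[OF that]] using that Suc const[of l e]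
      by (cases "mv (e mod N) = Some l") (simp_all add: index_mode s_def field_simps)
    moreover have "point x \<pi> (2 * Suc e) $ (D + l) = pos (Suc e mod N) 0 l" if "l < N" for l
      using eq[of "D + l"] that Suc nx_neq[OF iN[of e]]
      by (auto simp: index_mode nx_mod[symmetric] pos_def algebra_simps)
    ultimately show ?case by blast
  qed
  obtain \<sigma> where \<sigma>: "induces x \<pi> \<sigma>" using ex_induces[OF sched Modes_carrier x] ..
  note seg = induces_segment[OF sched Modes_carrier x \<sigma>]
  have "non_zeno \<pi>"
    unfolding non_zeno_def filterlim_at_top eventually_sequentially
  proof
    fix Z
    obtain n where "Z \<le> real n" using real_arch_simple by blast
    then show "\<exists>N. \<forall>j\<ge>N. Z \<le> time \<pi> j"
      using time_mono[OF sched, of "2 * n"] t[of n] by (intro exI[of _ "2 * n"]) fastforce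
  qed
  moreover have "\<sigma> \<tau> \<in> carrier_vec (D + N)
        \<and> (\<forall>l<N. \<sigma> \<tau> $ (D + l) = pos (e mod N) (\<tau> - real e) l)
        \<and> (\<forall>l<D. \<tau> = real e \<or> mv (e mod N) \<noteq> Some l \<longrightarrow> \<sigma> \<tau> $ l = z e l)
        \<and> (\<forall>l<D. - 2 \<le> \<sigma> \<tau> $ l \<and> \<sigma> \<tau> $ l \<le> 3)"
    if \<tau>: "real e \<le> \<tau>" "\<tau> \<le> real e + 1" for e \<tau>
  proof -
    have P': "\<And>l. l < D \<Longrightarrow> point x \<pi> (2 * e) $ l = z e l"
      "\<And>l. l < N \<Longrightarrow> point x \<pi> (2 * e) $ (D + l) = pos (e mod N) 0 l" using P by auto
    consider "\<tau> \<le> real e + s e" | "real e + s e \<le> \<tau>" by linarith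
    \<comment> \<open>\<open>a\<close> and \<open>b\<close> are the times spent on the edge so far
      with the upward and the downward mode.\<close>
    then obtain a b where ab: "0 \<le> a" "a \<le> 3 / 4" "0 \<le> b" "b \<le> 3 / 4" "a + b = \<tau> - real e"
      and \<sigma>\<tau>: "\<sigma> \<tau> \<in> carrier_vec (D + N)" "\<And>l. l < D + N \<Longrightarrow> \<sigma> \<tau> $ l = point x \<pi> (2 * e) $ l
        + a * mode (e mod N) 1 $ l + b * mode (e mod N) (- 1) $ l"
    proof cases
      case 1
      have "\<sigma> \<tau> = point x \<pi> (2 * e) + (\<tau> - real e) \<cdot>\<^sub>v mode (e mod N) 1"
        using seg[of "2 * e" \<tau>] \<tau> 1 by (simp add: t t' \<pi>)
      then show ?thesis using 1 \<tau> s[of e] pc[of "2 * e"]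
        by (intro that[of "\<tau> - real e" 0]) (auto simp: add mode_def)
    next
      case 2
      have "time \<pi> (Suc (Suc (2 * e))) = real e + 1" using t[of "Suc e"] by simp
      then have "\<sigma> \<tau> = point x \<pi> (2 * e) + s e \<cdot>\<^sub>v mode (e mod N) 1
          + (\<tau> - real e - s e) \<cdot>\<^sub>v mode (e mod N) (- 1)"
        using seg[of "Suc (2 * e)" \<tau>] \<tau> 2 by (simp add: t' \<pi> diff_diff_eq)
      then show ?thesis using 2 \<tau> s[of e] pc[of "2 * e"]
        by (intro that[of "s e" "\<tau> - real e - s e"]) (auto simp: add mode_def)
    qed
    have "\<sigma> \<tau> $ (D + l) = pos (e mod N) (\<tau> - real e) l" if "l < N" for l
      using \<sigma>\<tau>(2)[of "D + l"] P'(2)[OF that] that ab(5) nx_neq[OF iN[of e]]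
      by (auto simp: index_mode pos_def)
    moreover have "\<sigma> \<tau> $ l = z e l" if l: "l < D" "\<tau> = real e \<or> mv (e mod N) \<noteq> Some l" for l
    proof (cases "\<tau> = real e")
      case True
      then have "a = 0" "b = 0" using ab by linarith+
      then show ?thesis using \<sigma>\<tau>(2)[of l] P'(1)[OF l(1)] l by simp
    qed (use \<sigma>\<tau>(2)[of l] P'(1)[OF l(1)] l in \<open>simp add: index_mode\<close>)
    moreover have "- 2 \<le> \<sigma> \<tau> $ l \<and> \<sigma> \<tau> $ l \<le> 3" if "l < D" for l
      using \<sigma>\<tau>(2)[of l] P'(1)[OF that] that ab unit[OF that, of e] by (auto simp: index_mode)
    ultimately show ?thesis using \<sigma>\<tau>(1) by blast
  qed
  ultimately show ?thesis using sched \<sigma> unfolding follows_def by blast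
qed

text \<open>A single zone has to serve on the whole closed edge, so that one \<open>Until\<close>
  can bridge it. It does because the data are at rest on every edge with a check.\<close>

lemma edge_zone_along:
  assumes "e mod N = i" "mv i = None \<Longrightarrow> \<exists>C\<in>set (alts i). holds C (z e)"
    and \<sigma>: "follows z \<sigma>"
  shows "\<exists>Z\<in>set (edge_zones i). \<forall>\<tau>\<in>{real e..real e + 1}. \<sigma> \<tau> \<in> zone_set Z"
proof -
  have i: "i < N" using assms(1) N_ge by auto
  obtain C where C: "C \<in> set (alts i)" "mv i = None \<Longrightarrow> holds C (z e)" "mv i \<noteq> None \<Longrightarrow> C = []"
    using assms(2) mv_alts by (cases "mv i") auto
  have "\<sigma> \<tau> \<in> zone_set (edge_zone i C)" if \<tau>: "\<tau> \<in> {real e..real e + 1}" for \<tau>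
  proof -
    have "\<sigma> \<tau> \<in> carrier_vec (D + N)" and ctrl: "\<And>l. l < N \<Longrightarrow> \<sigma> \<tau> $ (D + l) = pos i (\<tau> - real e) l"
      and data: "\<And>l. l < D \<Longrightarrow> mv i \<noteq> Some l \<Longrightarrow> \<sigma> \<tau> $ l = z e l"
      and box: "\<forall>l<D. - 2 \<le> \<sigma> \<tau> $ l \<and> \<sigma> \<tau> $ l \<le> 3"
      using \<sigma>[unfolded follows_def, rule_format, of e \<tau>] \<tau> assms(1) by auto
    moreover have "holds C (($) (\<sigma> \<tau>))"
    proof (cases "mv i = None")
      case True
      then show ?thesis using C data holds_cong[OF alts_below[OF C(1)], of "($) (\<sigma> \<tau>)" "z e"] by simp
    qed (use C in simp)
    ultimately show ?thesis
      using edge_zone_iff[OF i alts_below[OF C(1)]] holds_edge_ineqs[OF i] i \<tau> nx_less[OF i]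
        nx_neq[OF i] by (auto simp: pos_def)
  qed
  then show ?thesis using C(1) unfolding edge_zones_def set_map by blast
qed

section \<open>Completeness of the two formulas\<close>

lemma chain_append: "chain \<phi> (Ys @ Zs) = chain (chain \<phi> Zs) Ys"
  by (simp add: chain_def)

text \<open>Every \<open>Until\<close> may be discharged at once; in this way a chain passes over
  the zones that are not visited.\<close>

lemma sat_chain_now: "sat \<sigma> \<tau> \<phi> \<Longrightarrow> sat \<sigma> \<tau> (chain \<phi> Zs)"
  by (induction Zs) (auto simp: chain_def)

lemma sat_chain_later:
  assumes "Z \<in> set Zs" "\<tau> \<le> \<tau>'" "\<forall>t\<in>{\<tau>..<\<tau>'}. \<sigma> t \<in> zone_set Z" "sat \<sigma> \<tau>' \<phi>"
  shows "sat \<sigma> \<tau> (chain \<phi> Zs)"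
  using assms(1)
proof (induction Zs)
  case (Cons Y Zs)
  show ?case
  proof (cases "Y = Z")
    case True
    then show ?thesis using assms(2-4) sat_chain_now[OF assms(4), of Zs] by (auto simp: chain_def)
  next
    case False
    then show ?thesis using Cons by (auto simp: chain_def)
  qed
qed simp

text \<open>Within each round the zones are visited in the order of the chain, up to the last edge.\<close>

lemma sat_chain_round:
  assumes vis: "\<And>i. i < N \<Longrightarrow>
      \<exists>Z\<in>set (edge_zones i). \<forall>\<tau>\<in>{c + real i..c + real i + 1}. \<sigma> \<tau> \<in> zone_set Z"
    and "i \<le> N - 1" "c + real i \<le> \<tau>" "\<tau> < c + real N"
  shows "sat \<sigma> \<tau> (chain (Atom (edge_zone (N - 1) fin)) (concat (map edge_zones [i..<N - 1])))"
  using assms(2-4)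
proof (induction i arbitrary: \<tau> rule: inc_induct)
  case base
  have "edge_zones (N - 1) = [edge_zone (N - 1) fin]" by (simp only: edge_zones_def alts_last list.map)
  then show ?case using vis[of "N - 1"] base N_ge by (auto simp: chain_def of_nat_diff)
next
  case (step i)
  obtain Z where Z: "Z \<in> set (edge_zones i)"
    "\<forall>\<tau>\<in>{c + real i..c + real i + 1}. \<sigma> \<tau> \<in> zone_set Z"
    using vis[of i] step.hyps(2) by (meson less_imp_diff_less less_le_trans diff_le_self)
  have split: "concat (map edge_zones [i..<N - 1]) = edge_zones i @ concat (map edge_zones [Suc i..<N - 1])"
    using step.hyps by (simp add: upt_conv_Cons)
  show ?case
  proof (cases "c + real (Suc i) \<le> \<tau>")
    case True
    then show ?thesis unfolding split chain_append using step.prems(2)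
      by (intro sat_chain_now[OF step.IH]) (use True in simp_all)
  next
    case False
    have "c + real (Suc i) < c + real N" using step.hyps by simp
    then have "sat \<sigma> (c + real (Suc i))
        (chain (Atom (edge_zone (N - 1) fin)) (concat (map edge_zones [Suc i..<N - 1])))"
      by (intro step.IH) simp_all
    then show ?thesis unfolding split chain_append using step.prems False Z
      by (intro sat_chain_later[of Z "edge_zones i" _ "c + real (Suc i)"]) auto
  qed
qed

lemma safe_complete:
  assumes "\<And>e l. l < D \<Longrightarrow> mv (e mod N) \<noteq> Some l \<Longrightarrow> z (Suc e) l = z e l"
    and "\<And>e l. l < D \<Longrightarrow> 0 \<le> z e l \<and> z e l \<le> 1" and "initial (z 0) x"
    and alts: "\<And>e. mv (e mod N) = None \<Longrightarrow> \<exists>C\<in>set (alts (e mod N)). holds C (z e)"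
  shows "models Modes x safe_formula"
proof -
  obtain \<pi> \<sigma> where \<pi>: "is_schedule Modes \<pi>" "non_zeno \<pi>" "induces x \<pi> \<sigma>"
    and \<sigma>: "follows z \<sigma>"
    using execution_exists[OF assms(1-3)] by blast
  have "inside (\<sigma> \<tau>)" if "0 \<le> \<tau>" for \<tau>
  proof -
    define e where "e = nat \<lfloor>\<tau>\<rfloor>"
    have e: "real e \<le> \<tau>" "\<tau> \<le> real e + 1" using that unfolding e_def by linarith+
    obtain Z where "Z \<in> set (edge_zones (e mod N))" "\<sigma> \<tau> \<in> zone_set Z"
      using edge_zone_along[OF refl alts \<sigma>, of e] e by auto
    moreover have "e mod N < N" using N_ge by simp
    ultimately show ?thesis unfolding inside_def by blast
  qed
  then have "sat \<sigma> 0 safe_formula" by (simp add: safe_formula_def sat_either inside_iff_zones)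
  then show ?thesis using \<pi> unfolding models_def by blast
qed

text \<open>The constraints are assumed only before the target. The schedule must go on forever, but
  nothing is asked of the execution afterwards; this matters because a halted configuration
  satisfies no step constraint.\<close>

lemma reach_complete:
  assumes "\<And>e l. l < D \<Longrightarrow> mv (e mod N) \<noteq> Some l \<Longrightarrow> z (Suc e) l = z e l"
    and "\<And>e l. l < D \<Longrightarrow> 0 \<le> z e l \<and> z e l \<le> 1" and "initial (z 0) x"
    and alts: "\<And>e. e < n * N \<Longrightarrow> mv (e mod N) = None \<Longrightarrow> \<exists>C\<in>set (alts (e mod N)). holds C (z e)"
    and tgt: "holds tgt (z (n * N))"
  shows "models Modes x reach_formula"
proof -
  obtain \<pi> \<sigma> where \<pi>: "is_schedule Modes \<pi>" "non_zeno \<pi>" "induces x \<pi> \<sigma>"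
    and \<sigma>: "follows z \<sigma>"
    using execution_exists[OF assms(1-3)] by blast
  have "sat \<sigma> \<tau> (chain (Atom (edge_zone (N - 1) fin)) inner_zones)" if \<tau>: "0 \<le> \<tau>" "\<tau> < real (n * N)" for \<tau>
  proof -
    define e where "e = nat \<lfloor>\<tau>\<rfloor>"
    define m where "m = e div N"
    have e: "real e \<le> \<tau>" "\<tau> < real e + 1" using \<tau>(1) unfolding e_def by linarith+
    have "e < n * N" using e(1) \<tau>(2) by linarith
    then have m: "m < n" unfolding m_def by (simp add: less_mult_imp_div_less)
    \<comment> \<open>The whole current round precedes the target, so all its constraints are
      available.\<close>
    have "m * N + N \<le> n * N" using m by (metis Suc_leI add.commute mult_Suc mult_le_mono1)
    then have below: "m * N + i < n * N" if "i < N" for i using that by linarith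
    have "e = m * N + e mod N" "e mod N < N" using N_ge by (simp_all add: m_def)
    then have "m * N \<le> e" "Suc e \<le> m * N + N" by linarith+
    then have "real (m * N) \<le> real e" "real (Suc e) \<le> real (m * N + N)"
      unfolding of_nat_le_iff by simp_all
    then have m': "real (m * N) \<le> \<tau>" "\<tau> < real (m * N) + real N" using e by linarith+
    have "\<exists>Z\<in>set (edge_zones i). \<forall>\<tau>\<in>{real (m * N) + real i..real (m * N) + real i + 1}. \<sigma> \<tau> \<in> zone_set Z"
      if "i < N" for i
    proof -
      have "(m * N + i) mod N = i" using that by simp
      with edge_zone_along[OF this _ \<sigma>] alts[OF below[OF that]] show ?thesis by simp
    qed
    then show ?thesis
      using sat_chain_round[of "real (m * N)" \<sigma> 0 \<tau>] m' unfolding inner_zones_def by simp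
  qed
  moreover have "\<sigma> (real (n * N)) \<in> zone_set target"
  proof -
    have mod: "n * N mod N = 0" by simp
    have z: "\<sigma> (real (n * N)) \<in> carrier_vec (D + N)"
      "\<forall>l<N. \<sigma> (real (n * N)) $ (D + l) = pos 0 0 l"
      "\<forall>l<D. \<sigma> (real (n * N)) $ l = z (n * N) l"
      "\<forall>l<D. - 2 \<le> \<sigma> (real (n * N)) $ l \<and> \<sigma> (real (n * N)) $ l \<le> 3"
      using \<sigma>[unfolded follows_def, rule_format, of "n * N" "real (n * N)"] unfolding mod by auto
    have "holds tgt (($) (\<sigma> (real (n * N))))"
      using tgt holds_cong[OF tgt_below, of "($) (\<sigma> (real (n * N)))" "z (n * N)"] z(3) by simp
    then show ?thesis using z(1,2,4) N_ge nx_less[of 0] nx_neq[of 0] z(2)[rule_format, of 0]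
      by (auto simp: target_iff holds_edge_ineqs pos_def)
  qed
  ultimately have "sat \<sigma> 0 reach_formula"
    unfolding reach_formula_def sat.simps by (intro exI[of _ "real (n * N)"]) simp
  then show ?thesis using \<pi> unfolding models_def by blast
qed


subsection \<open>The formulas belong to the fragments\<close>

lemma bounded_zones:
  assumes "Z \<in> insert (edge_zone (N - 1) fin) (insert target (set inner_zones))"
  shows "is_zone (D + N) Z \<and> bounded_zone Z"
proof -
  consider "Z = target" | i C where "i < N" "C \<in> set (alts i)" "Z = edge_zone i C"
  proof -
    have "set inner_zones = (\<Union>i<N - 1. edge_zone i ` set (alts i))"
      by (simp add: inner_zones_def edge_zones_def atLeast0LessThan)
    then have "Z = target \<or> Z = edge_zone (N - 1) fin \<or> (\<exists>i<N - 1. \<exists>C\<in>set (alts i). Z = edge_zone i C)"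
      using assms by blast
    moreover have "i < N" if "i < N - 1" for i using that by simp
    moreover have "fin \<in> set (alts (N - 1))" "N - 1 < N" using N_ge unfolding alts_last by simp_all
    ultimately show thesis using that by blast
  qed
  then show ?thesis
  proof cases
    case 1
    have "bounded_zone target"
      by (rule bounded_if_edge_ineqs[of 0 _ tgt]) (use N_ge in \<open>simp_all add: target_iff\<close>)
    then show ?thesis using 1 is_zone_zone_of by (simp add: target_def)
  next
    case 2
    have "bounded_zone (edge_zone i C)"
      by (rule bounded_if_edge_ineqs[of i _ C, OF 2(1)]) (simp add: edge_zone_iff[OF 2(1) alts_below[OF 2(2)]])
    then show ?thesis using 2(3) is_zone_zone_of by (simp add: edge_zone_def)
  qed
qed

lemma reach_formula_fragment: "reach_formula \<in> LTL\<^sub>B (D + N) {UOp}"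
proof -
  have "operators (chain (Atom Z) Zs) \<subseteq> {UOp}" "zones (chain (Atom Z) Zs) = insert Z (set Zs)" for Z Zs
    unfolding chain_def by (induction Zs) auto
  then show ?thesis using bounded_zones by (simp add: LTL\<^sub>B_def reach_formula_def)
qed

lemma safe_formula_fragment: "safe_formula \<in> LTL\<^sub>B (D + N) {GOp, OrOp}"
proof -
  have "operators (either (Atom Z) Zs) \<subseteq> {GOp, OrOp}" "zones (either (Atom Z) Zs) = insert Z (set Zs)" for Z Zs
    unfolding either_def by (induction Zs) auto
  then show ?thesis using bounded_zones by (simp add: LTL\<^sub>B_def safe_formula_def)
qed

end


section \<open>Simulating goto programs\<close>

fun regs :: "instr \<Rightarrow> nat set" where
  "regs (IClear r q) = {r}"
| "regs (ICopy r s q) = {r, s}"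
| "regs (IInc r q) = {r}"
| "regs (IJzd r q q') = {r}"

fun targets :: "instr \<Rightarrow> nat set" where
  "targets (IClear r q) = {q}"
| "targets (ICopy r s q) = {q}"
| "targets (IInc r q) = {q}"
| "targets (IJzd r q q') = {q, q'}"

definition eqn :: "(int \<times> nat) list \<Rightarrow> int \<Rightarrow> ineq list" where
  "eqn ts c = [(ts, c), (map (\<lambda>(a, l). (- a, l)) ts, - c)]"

lemma holds_eqn: "holds (eqn ts c) p \<longleftrightarrow> lin ts p = of_int c"
proof -
  have "lin (map (\<lambda>(a, l). (- a, l)) ts) p = - lin ts p" by (induction ts) auto
  then show ?thesis by (auto simp: eqn_def)
qed

lemma uses_below_eqn: "uses_below d (eqn ts c) \<longleftrightarrow> (\<forall>t\<in>set ts. snd t < d)"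
  by (auto simp: eqn_def)

text \<open>A configuration is stored in \<open>K + 1\<close> data coordinates: register \<open>r\<close> with value \<open>a\<close> as
  \<open>1 / 2 ^ a\<close> in coordinate \<open>r\<close>, and the address \<open>q\<close> as \<open>q / B\<close> in coordinate \<open>K\<close>. A second block of
  \<open>K + 1\<close> coordinates is used to guess the next configuration: the first edges of the cycle change
  the second block, edge \<open>k\<close> checks that it is the successor of the first block, the next edges
  change the first block, and the last one checks that the blocks are equal.\<close>

locale machine =
  fixes prog :: "instr list" and K B :: nat
  assumes regs_less: "i \<in> set prog \<Longrightarrow> r \<in> regs i \<Longrightarrow> r < K"
    and targets_le: "i \<in> set prog \<Longrightarrow> q \<in> targets i \<Longrightarrow> q \<le> B"
    and B_pos: "0 < B"
begin

definition k :: nat where "k = Suc K"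

definition period :: nat where "period = 2 * k + 2"

lemma period_pos [simp]: "0 < period"
  by (simp add: period_def)

definition mv :: "nat \<Rightarrow> nat option" where
  "mv i = (if i < k then Some (k + i) else if k < i \<and> i \<le> 2 * k then Some (i - Suc k) else None)"

definition frame :: "nat \<Rightarrow> ineq list" where
  "frame r = concat (map (\<lambda>l. eqn [(1, k + l), (-1, l)] 0) (filter (\<lambda>l. l \<noteq> r) [0..<K]))"

text \<open>Scaling the address coordinates by \<open>B\<close> keeps all coefficients integral, as
  zones require.\<close>

definition assign :: "nat \<Rightarrow> nat \<Rightarrow> nat \<Rightarrow> (int \<times> nat) list \<Rightarrow> int \<Rightarrow> ineq list" where
  "assign p q r ts c = eqn [(int B, K)] (int p) @ eqn [(int B, k + K)] (int q) @ eqn ts c @ frame r"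

text \<open>In terms of \<open>1 / 2 ^ a\<close>, the counter 0 is the value 1, incrementing halves,
  decrementing doubles, and a counter is positive when its value is at most 1/2. The closed
  conditions for zero and for positive counters are therefore disjoint.\<close>

fun branches :: "nat \<Rightarrow> instr \<Rightarrow> ineq list list" where
  "branches p (IClear r q) = [assign p q r [(1, k + r)] 1]"
| "branches p (ICopy r s q) = [assign p q r [(1, k + r), (-1, s)] 0]"
| "branches p (IInc r q) = [assign p q r [(2, k + r), (-1, r)] 0]"
| "branches p (IJzd r q q') =
    [eqn [(1, r)] 1 @ assign p q r [(1, k + r), (-1, r)] 0,
     ([(2, r)], 1) # assign p q' r [(1, k + r), (-2, r)] 0]"

definition fin :: "ineq list" where
  "fin = concat (map (\<lambda>l. eqn [(1, l), (-1, k + l)] 0) [0..<k])"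

definition tgt :: "ineq list" where
  "tgt = [([(- int B, K)], - int (length prog))]"

definition alts :: "nat \<Rightarrow> ineq list list" where
  "alts i = (if i = k then concat (map (\<lambda>p. branches p (prog ! p)) [0..<length prog])
     else if i = 2 * k + 1 then [fin] else [[]])"

lemma period_gt: "2 * k + 1 < period"
  by (simp add: period_def)

lemma holds_assign:
  "holds (assign p q r ts c) x \<longleftrightarrow> real B * x K = real p \<and> real B * x (k + K) = real q
    \<and> lin ts x = of_int c \<and> (\<forall>l<K. l \<noteq> r \<longrightarrow> x (k + l) = x l)"
  by (auto simp: assign_def frame_def holds_eqn)

lemma uses_below_assign:
  "(\<forall>t\<in>set ts. snd t < 2 * k) \<Longrightarrow> uses_below (2 * k) (assign p q r ts c)"
  by (auto simp: assign_def frame_def uses_below_eqn k_def)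

lemma uses_below_branches:
  assumes "i \<in> set prog" "C \<in> set (branches p i)"
  shows "uses_below (2 * k) C"
proof -
  have "\<forall>r\<in>regs i. r < k \<and> r < 2 * k" using regs_less[OF assms(1)] by (fastforce simp: k_def)
  then show ?thesis using assms(2)
    by (cases i) (auto simp: uses_below_eqn intro!: uses_below_assign)
qed

sublocale cycle "2 * k" period mv alts fin tgt
proof
  show "uses_below (2 * k) C" if C: "C \<in> set (alts i)" for C i
  proof (cases "i = k")
    case True
    then obtain p where "p < length prog" "C \<in> set (branches p (prog ! p))"
      using C by (auto simp: alts_def)
    then show ?thesis using uses_below_branches nth_mem by blast
  next
    case False
    have "uses_below (2 * k) fin" by (simp add: fin_def uses_below_eqn)
    then show ?thesis using C False by (auto simp: alts_def split: if_splits)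
  qed
qed (auto simp: k_def period_def mv_def alts_def tgt_def split: if_splits)

section \<open>One machine step as linear constraints\<close>

definition enc :: "nat \<times> (nat \<Rightarrow> nat) \<Rightarrow> nat \<Rightarrow> real" where
  "enc c l = (if l < K then 1 / 2 ^ snd c l else real (fst c) / real B)"

lemma enc_update:
  assumes "r < K"
  shows "(\<forall>l<k. x (k + l) = enc (q, v(r := a)) l) \<longleftrightarrow> real B * x (k + K) = real q
    \<and> x (k + r) = 1 / 2 ^ a \<and> (\<forall>l<K. l \<noteq> r \<longrightarrow> x (k + l) = 1 / 2 ^ v l)"
proof -
  have "(\<forall>l<k. x (k + l) = enc (q, v(r := a)) l) \<longleftrightarrow>
      x (k + K) = real q / real B \<and> (\<forall>l<K. x (k + l) = 1 / 2 ^ (v(r := a)) l)"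
    unfolding k_def All_less_Suc by (simp add: enc_def)
  also have "x (k + K) = real q / real B \<longleftrightarrow> real B * x (k + K) = real q"
    using B_pos by (auto simp: field_simps)
  also have "(\<forall>l<K. x (k + l) = 1 / 2 ^ (v(r := a)) l) \<longleftrightarrow>
      x (k + r) = 1 / 2 ^ a \<and> (\<forall>l<K. l \<noteq> r \<longrightarrow> x (k + l) = 1 / 2 ^ v l)"
    using assms by auto
  finally show ?thesis .
qed

text \<open>The equations determine every coordinate of the second block, so only the correct guess
  passes; the address equation excludes the branches of all other instructions.\<close>

lemma branches_iff:
  assumes p: "p < length prog" and x: "\<forall>l<k. x l = enc c l"
  shows "(\<exists>C\<in>set (branches p (prog ! p)). holds C x) \<longleftrightarrow>
    fst c = p \<and> (\<forall>l<k. x (k + l) = enc (perform (prog ! p) (snd c)) l)"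
proof -
  obtain q v where c: "c = (q, v)" by (cases c)
  have xl: "x l = 1 / 2 ^ v l" if "l < K" for l using x that by (simp add: c enc_def k_def)
  have xK: "real B * x K = real p \<longleftrightarrow> q = p" using x B_pos by (simp add: c enc_def k_def)
  have r: "r < K" if "r \<in> regs (prog ! p)" for r using regs_less[OF nth_mem[OF p] that] .
  have frame: "(\<forall>l<K. l \<noteq> r \<longrightarrow> x (k + l) = x l) \<longleftrightarrow> (\<forall>l<K. l \<noteq> r \<longrightarrow> x (k + l) = 1 / 2 ^ v l)" for r
    by (simp add: xl)
  show ?thesis
  proof (cases "prog ! p")
    case (IClear r q')
    then show ?thesis using r[of r] by (simp add: c holds_assign xK frame enc_update)
  next
    case (ICopy r s q')
    then show ?thesis using r[of r] r[of s] by (simp add: c holds_assign xK frame enc_update xl)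
  next
    case (IInc r q')
    have "2 * y = 1 / 2 ^ a \<longleftrightarrow> y = 1 / 2 ^ Suc a" for y :: real and a
      by (auto simp: field_simps)
    then show ?thesis using r[of r] IInc
      by (simp add: c holds_assign xK frame enc_update xl del: power_Suc)
  next
    case (IJzd r q1 q2)
    then have rK: "r < K" using r by simp
    show ?thesis
    proof (cases "v r")
      case 0
      have "v = v(r := 0)" using 0 by auto
      then show ?thesis using enc_update[OF rK, of x q1 v 0] IJzd 0
        by (auto simp: c holds_assign holds_eqn xK frame xl[OF rK])
    next
      case (Suc a)
      \<comment> \<open>The stored value of a positive counter fails the zero test and passes the
        other one.\<close>
      have "(2::real) * 2 ^ a \<noteq> 1" "(2::real) / (2 * 2 ^ a) \<le> 1"
        using one_le_power[of "2::real" a] by (simp_all del: one_le_power add: field_simps)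
      then show ?thesis using enc_update[OF rK, of x q2 v a] IJzd Suc
        by (auto simp: c holds_assign holds_eqn xK frame xl[OF rK])
    qed
  qed
qed

text \<open>A halted address selects no instruction, so the checking edge cannot be crossed: halting
  shows up as being stuck.\<close>

lemma alts_step_iff:
  assumes "\<forall>l<k. x l = enc c l"
  shows "(\<exists>C\<in>set (alts k). holds C x) \<longleftrightarrow>
    \<not> halted prog c \<and> (\<forall>l<k. x (k + l) = enc (step prog c) l)"
proof -
  have "(\<exists>C\<in>set (alts k). holds C x) \<longleftrightarrow>
      (\<exists>p<length prog. \<exists>C\<in>set (branches p (prog ! p)). holds C x)"
    by (auto simp: alts_def)
  also have "\<dots> \<longleftrightarrow> (\<exists>p<length prog. fst c = p \<and>
      (\<forall>l<k. x (k + l) = enc (perform (prog ! p) (snd c)) l))"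
    using branches_iff[OF _ assms] by blast
  finally show ?thesis by (auto simp: step_def halted_def not_le)
qed

lemma alts_last_iff: "(\<exists>C\<in>set (alts (2 * k + 1)). holds C x) \<longleftrightarrow> (\<forall>l<k. x l = x (k + l))"
  by (simp add: alts_def fin_def holds_eqn atLeast0LessThan lessThan_def)

section \<open>Runs of the program as data along the cycle\<close>

definition run :: "(nat \<Rightarrow> nat) \<Rightarrow> nat \<Rightarrow> nat \<times> (nat \<Rightarrow> nat)" where
  "run v n = (step prog ^^ n) (0, v)"

lemma run_Suc: "run v (Suc n) = step prog (run v n)"
  by (simp add: run_def)

definition start_data :: "(nat \<Rightarrow> nat) \<Rightarrow> nat \<Rightarrow> real" where
  "start_data v l = (if l < k then enc (0, v) l else 0)"

text \<open>The information is always carried by the block at rest: by the first block until the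
  step check on edge \<open>k\<close> transfers it to the second, and by the second until the
  equality check on the last edge transfers it back. Nothing is claimed about the block being
  guessed.\<close>

lemma reach_run:
  assumes "reach (start_data v) e z" "e = n * period + i" "i < period"
  shows "if i \<le> k then \<forall>l<k. z l = enc (run v n) l
    else \<not> halted prog (run v n) \<and> (\<forall>l<k. z (k + l) = enc (run v (Suc n)) l)"
  using assms
proof (induction arbitrary: n i)
  case (reach_0 z)
  then show ?case by (simp add: start_data_def run_def)
next
  case (reach_Suc e z z')
  show ?case
  proof (cases i)
    case 0
    then obtain m where n: "n = Suc m" using reach_Suc.prems by (cases n) auto
    have e: "e = m * period + (2 * k + 1)" using reach_Suc.prems 0 n by (simp add: period_def)
    then have mod: "e mod period = 2 * k + 1" using period_gt by simp
    have "\<forall>l<k. z (k + l) = enc (run v (Suc m)) l" using reach_Suc.IH[OF e period_gt] by simp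
    moreover have "\<forall>l<k. z l = z (k + l)"
      using reach_Suc.hyps(3) unfolding mod alts_last_iff by (simp add: mv_def)
    moreover have "\<forall>l<k. z' l = z l"
      using reach_Suc.hyps(2) unfolding mod by (simp add: mv_def)
    ultimately show ?thesis using n 0 by simp
  next
    case (Suc j)
    have e: "e = n * period + j" "j < period" using reach_Suc.prems Suc by simp_all
    then have mod: "e mod period = j" by simp
    note IH = reach_Suc.IH[OF e]
    note same = reach_Suc.hyps(2)[unfolded mod]
    consider "j < k" | "j = k" | "k < j" by linarith
    then show ?thesis
    proof cases
      case 1
      then have "\<forall>l<k. z' l = z l" using same by (simp add: mv_def)
      then show ?thesis using IH 1 Suc by simp
    next
      case 2
      have "mv k = None" by (simp add: mv_def)
      then have "\<exists>C\<in>set (alts k). holds C z" using reach_Suc.hyps(3) unfolding mod 2 by simp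
      moreover have "\<forall>l<k. z l = enc (run v n) l" using IH 2 by simp
      moreover have "\<forall>l<k. z' (k + l) = z (k + l)" using same \<open>mv k = None\<close> 2 by simp
      ultimately show ?thesis using 2 Suc alts_step_iff[of z "run v n"] by (simp add: run_Suc)
    next
      case 3
      have "\<forall>l<k. z' (k + l) = z (k + l)"
        using same 3 reach_Suc.prems(2) Suc by (auto simp: mv_def period_def)
      then show ?thesis using IH 3 Suc by simp
    qed
  qed
qed

text \<open>Edge \<open>j\<close> has taken effect when \<open>i > j\<close>. Edge
  \<open>l + k + 1\<close> moves coordinate \<open>l\<close> of the first block, and edge
  \<open>l - k\<close> moves coordinate \<open>l\<close> of the second. The default 0 is the content
  of the second block in \<open>start_data\<close>, before anything has been guessed.\<close>

definition path :: "(nat \<Rightarrow> nat) \<Rightarrow> nat \<Rightarrow> nat \<Rightarrow> real" where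
  "path v e l = (let n = e div period; i = e mod period in
     if l < k then enc (run v (if l + k + 1 < i then Suc n else n)) l
     else if l - k < i then enc (run v (Suc n)) (l - k)
     else if n = 0 then 0 else enc (run v n) (l - k))"

lemma path_round:
  assumes "i < period"
  shows "path v (n * period + i) l =
    (if l < k then enc (run v (if l + k + 1 < i then Suc n else n)) l
     else if l - k < i then enc (run v (Suc n)) (l - k)
     else if n = 0 then 0 else enc (run v n) (l - k))"
proof -
  have "(n * period + i) div period = n" "(n * period + i) mod period = i"
    using assms by simp_all
  then show ?thesis unfolding path_def Let_def by (simp only:)
qed

lemma path_const:
  assumes l: "l < 2 * k" and mv: "mv (e mod period) \<noteq> Some l"
  shows "path v (Suc e) l = path v e l"
proof -
  define n i where "n = e div period" and "i = e mod period"
  have e: "e = n * period + i" "i < period" by (simp_all add: n_def i_def)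
  show ?thesis
  proof (cases "i = 2 * k + 1")
    case True
    \<comment> \<open>After the last move of round \<open>n\<close> both blocks encode configuration
      \<open>Suc n\<close>, just as at the start of the next round.\<close>
    then have eq: "Suc e = Suc n * period + 0" using e by (simp add: period_def)
    show ?thesis
      using path_round[of 0 v "Suc n" l, folded eq] path_round[OF e(2), of v n l, folded e(1)] True l
      by auto
  next
    case False
    then have "Suc e = n * period + Suc i" "Suc i < period" using e by (simp_all add: period_def)
    moreover have "l + k + 1 < Suc i \<longleftrightarrow> l + k + 1 < i" if "l < k"
      using mv[folded i_def] that e(2) False by (auto simp: mv_def period_def split: if_splits)
    moreover have "l - k < Suc i \<longleftrightarrow> l - k < i" if "\<not> l < k"
      using mv[folded i_def] that l by (auto simp: mv_def split: if_splits)
    ultimately show ?thesis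
      using path_round[of "Suc i" v n l] path_round[OF e(2), of v n l] e(1) by auto
  qed
qed

text \<open>Keeps the address coordinate \<open>q / B\<close> in the unit interval, as
  \<open>execution_exists\<close> demands of the data.\<close>

lemma run_le: "fst (run v n) \<le> B"
proof (induction n)
  case (Suc n)
  have "fst (perform i w) \<in> targets i" for i w by (cases i) auto
  then show ?case using Suc targets_le[OF nth_mem]
    by (auto simp: run_Suc step_def halted_def not_le)
qed (simp add: run_def)

lemma path_unit: "0 \<le> path v e l \<and> path v e l \<le> 1"
proof -
  have "0 \<le> enc (run v n) l \<and> enc (run v n) l \<le> 1" for n l
    using run_le[of v n] B_pos by (simp add: enc_def)
  then show ?thesis by (simp add: path_def Let_def)
qed

lemma path_alts:
  assumes "mv (e mod period) = None" "\<not> halted prog (run v (e div period))"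
  shows "\<exists>C\<in>set (alts (e mod period)). holds C (path v e)"
proof -
  define n i where "n = e div period" and "i = e mod period"
  have e: "e = n * period + i" "i < period" by (simp_all add: n_def i_def)
  have path: "path v e l = (if l < k then enc (run v (if l + k + 1 < i then Suc n else n)) l
     else if l - k < i then enc (run v (Suc n)) (l - k)
     else if n = 0 then 0 else enc (run v n) (l - k))" for l
    using path_round[OF e(2), of v n l] e(1) by simp
  have "mv i = None" using assms(1) by (simp only: i_def)
  then have "i = k \<or> i = 2 * k + 1" using e(2) by (auto simp: mv_def period_def split: if_splits)
  then show ?thesis
  proof
    assume i: "i = k"
    then show ?thesis
      using alts_step_iff[of "path v e" "run v n"] assms(2) path
      by (simp add: run_Suc i_def[symmetric] n_def[symmetric])
  next
    assume i: "i = 2 * k + 1"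
    then show ?thesis using alts_last_iff[of "path v e"] path
      unfolding i_def[symmetric] i by simp
  qed
qed

section \<open>Equivalence of the formulas with halting and divergence\<close>

lemma path_start: "l < 2 * k \<Longrightarrow> path v 0 l = start_data v l"
  by (simp add: path_def start_data_def run_def)

lemma initial_path: "initial (start_data v) x \<Longrightarrow> initial (path v 0) x"
  unfolding initial_def using path_start by simp

lemma tgt_iff: "x K = enc c K \<Longrightarrow> holds tgt x \<longleftrightarrow> halted prog c"
  using B_pos by (simp add: tgt_def enc_def halted_def)

lemma reach_iff_halts:
  assumes x: "initial (start_data v) x"
  shows "models Modes x reach_formula \<longleftrightarrow> halts_on prog v"
proof
  assume "models Modes x reach_formula"
  then obtain n z where "reach (start_data v) (n * period) z" and t: "holds tgt z"
    using reach_sound[OF _ x] by blast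
  then have "z K = enc (run v n) K" using reach_run[of v _ z n 0] by (simp add: k_def)
  then show "halts_on prog v" using t tgt_iff by (auto simp: halts_on_def run_def)
next
  assume h: "halts_on prog v"
  \<comment> \<open>It has to be the first halting time: any later one is preceded by a halted
    configuration, whose step check fails.\<close>
  define n where "n = (LEAST n. halted prog (run v n))"
  have n: "halted prog (run v n)"
    using h unfolding halts_on_def n_def run_def by (rule LeastI_ex)
  have before: "\<not> halted prog (run v m)" if "m < n" for m
    using that not_less_Least unfolding n_def by blast
  show "models Modes x reach_formula"
  proof (rule reach_complete[OF path_const path_unit initial_path[OF x]])
    fix e assume "e < n * period" "mv (e mod period) = None"
    then show "\<exists>C\<in>set (alts (e mod period)). holds C (path v e)"
      by (intro path_alts before) (simp_all only: less_mult_imp_div_less)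
  next
    have "path v (n * period + 0) K = enc (run v n) K"
      by (subst path_round) (simp_all add: k_def)
    then show "holds tgt (path v (n * period))" using n tgt_iff by simp
  qed
qed

lemma safe_iff_not_halts:
  assumes x: "initial (start_data v) x"
  shows "models Modes x safe_formula \<longleftrightarrow> \<not> halts_on prog v"
proof
  assume m: "models Modes x safe_formula"
  have "\<not> halted prog (run v n)" for n
  proof -
    \<comment> \<open>Position \<open>k + 1\<close> lies just behind the step check of round
      \<open>n\<close>, which no halted configuration passes.\<close>
    obtain z where "reach (start_data v) (n * period + (k + 1)) z"
      using safe_sound[OF m x] by blast
    then show ?thesis using reach_run[of v _ z n "k + 1"] by (simp add: period_def)
  qed
  then show "\<not> halts_on prog v" by (simp add: halts_on_def run_def)
next
  assume "\<not> halts_on prog v"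
  then have "\<not> halted prog (run v n)" for n by (simp add: halts_on_def run_def)
  then show "models Modes x safe_formula"
    by (intro safe_complete[OF path_const path_unit initial_path[OF x]] path_alts)
qed

text \<open>In order: the remaining registers, whose content 0 is stored as 1; the address 0 and the
  second block, together \<open>k + 1\<close> zeros; the control point at vertex 0.\<close>

definition padding :: "nat \<Rightarrow> rat list" where
  "padding m = replicate (K - m) 1 @ replicate (k + 1) 0 @ 1 # replicate (2 * k + 1) 0"

lemma initial_padding:
  fixes ws :: "nat list"
  assumes ws: "length ws \<le> K"
  shows "initial (start_data (\<lambda>r. if r < length ws then ws ! r else 0))
    (map_vec real_of_rat (vec_of_list (map (\<lambda>a. 1 / 2 ^ a) ws @ padding (length ws))))"
proof -
  define xs where "xs = map (\<lambda>a. 1 / 2 ^ a :: rat) ws @ padding (length ws)"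
  have dim: "length xs = 2 * k + period"
    using assms by (simp add: xs_def padding_def k_def period_def)
  have nth: "map_vec real_of_rat (vec_of_list xs) $ l = real_of_rat (xs ! l)"
    if "l < 2 * k + period" for l
    using that dim by (simp add: vec_of_list_index)
  have data: "xs ! l = (if l < length ws then 1 / 2 ^ (ws ! l) else if l < K then 1 else 0)"
    if l: "l < 2 * k" for l
  proof -
    consider "l < length ws" | "length ws \<le> l" "l < K" | "K \<le> l" by linarith
    then show ?thesis
    proof cases
      case 3
      then have "l - K < k + 1" using l by (simp add: k_def)
      then have "(replicate (k + 1) 0 @ 1 # replicate (2 * k + 1) 0) ! (l - K) = (0 :: rat)"
        by (simp only: nth_append length_replicate nth_replicate if_True)
      then show ?thesis using 3 ws by (simp add: xs_def padding_def nth_append del: replicate_Suc)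
    qed (simp_all add: xs_def padding_def nth_append)
  qed
  have ctrl: "xs ! (2 * k + l) = (if l = 0 then 1 else 0)" if "l < period" for l
  proof -
    have "xs = (map (\<lambda>a. 1 / 2 ^ a) ws @ replicate (K - length ws) 1 @ replicate (k + 1) 0)
        @ 1 # replicate (2 * k + 1) 0" by (simp add: xs_def padding_def)
    moreover have "length (map (\<lambda>a. 1 / 2 ^ a :: rat) ws @ replicate (K - length ws) 1
        @ replicate (k + 1) 0) = 2 * k" using ws by (simp add: k_def)
    ultimately have "xs ! (2 * k + l) = (1 # replicate (2 * k + 1) 0) ! l"
      by (metis nth_append_length_plus)
    then show ?thesis using that by (simp add: nth_Cons' period_def del: replicate_Suc)
  qed
  have "map_vec real_of_rat (vec_of_list xs) \<in> carrier_vec (2 * k + period)"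
    using dim by (intro carrier_vecI) simp
  moreover have "map_vec real_of_rat (vec_of_list xs) $ l
      = start_data (\<lambda>r. if r < length ws then ws ! r else 0) l" if "l < 2 * k" for l
    unfolding nth[OF trans_less_add1[OF that]] data[OF that] start_data_def enc_def
    using ws that by (simp add: k_def of_rat_divide of_rat_power)
  moreover have "map_vec real_of_rat (vec_of_list xs) $ (2 * k + l) = pos 0 0 l"
    if "l < period" for l
    using nth[of "2 * k + l"] ctrl[OF that] that by (simp add: pos_def)
  ultimately show ?thesis unfolding initial_def xs_def by blast
qed

end

lemma machine_exists:
  obtains K B where "machine prog K B" "m \<le> K"
proof -
  have "finite (regs i)" "finite (targets i)" for i by (cases i; simp)+
  then have fin: "finite (\<Union>i\<in>set prog. regs i)" "finite (\<Union>i\<in>set prog. targets i)" by auto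
  obtain K where K: "\<forall>r\<in>(\<Union>i\<in>set prog. regs i). r < K"
    using fin(1) unfolding finite_nat_set_iff_bounded by blast
  obtain B where B: "\<forall>q\<in>(\<Union>i\<in>set prog. targets i). q < B"
    using fin(2) unfolding finite_nat_set_iff_bounded by blast
  show thesis
  proof (rule that[of "max K m" "Suc B"])
    show "machine prog (max K m) (Suc B)"
    proof
      show "r < max K m" if "i \<in> set prog" "r \<in> regs i" for i r
        using K that by fastforce
      show "q \<le> Suc B" if "i \<in> set prog" "q \<in> targets i" for i q
        using B that by fastforce
    qed simp
  qed simp
qed


section \<open>Recursive functions on codes\<close>

lemma computes_Comp1:
  "computes g xs a \<Longrightarrow> computes f [a] y \<Longrightarrow> computes (Comp f [g]) xs y"
  by (rule computes_Comp[of xs _ "[a]"]) auto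

lemma computes_Comp2:
  "computes g xs a \<Longrightarrow> computes h xs b \<Longrightarrow> computes f [a, b] y \<Longrightarrow> computes (Comp f [g, h]) xs y"
  by (rule computes_Comp[of xs _ "[a, b]"]) auto

lemma computes_ProjI: "i < length xs \<Longrightarrow> y = xs ! i \<Longrightarrow> computes (Proj i) xs y"
  using computes_Proj by simp

fun r_const :: "nat \<Rightarrow> recf" where
  "r_const 0 = Zero"
| "r_const (Suc n) = Comp Succ [r_const n]"

definition r_add :: recf where
  "r_add = PrimRec (Proj 0) (Comp Succ [Proj 1])"

definition r_triangle :: recf where
  "r_triangle = PrimRec Zero (Comp Succ [Comp r_add [Proj 0, Proj 1]])"

text \<open>Cantor pairing: \<open>prod_encode (m, n)\<close> is
  \<open>triangle (m + n) + m\<close>.\<close>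

definition r_pair :: recf where
  "r_pair = Comp r_add [Comp r_triangle [r_add], Proj 0]"

definition r_power2 :: recf where
  "r_power2 = PrimRec (r_const 1) (Comp r_add [Proj 1, Proj 1])"

text \<open>Follows \<open>list_encode\<close>, which codes a nonempty list by the successor of the
  paired head and tail codes.\<close>

definition r_cons :: "recf \<Rightarrow> recf \<Rightarrow> recf" where
  "r_cons f g = Comp Succ [Comp r_pair [f, g]]"

lemma computes_const: "computes (r_const n) xs n"
  by (induction n) (auto intro: computes_Comp1 computes.intros)

lemma computes_add: "computes r_add [m, n] (m + n)"
proof (induction m)
  case 0
  show ?case unfolding r_add_def by (auto intro!: computes_PrimRec_0 computes_ProjI)
next
  case (Suc m)
  then show ?case unfolding r_add_def
    by (auto intro!: computes_PrimRec_Suc computes_Comp1[OF _ computes_Succ] computes_ProjI)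
qed

lemma computes_triangle: "computes r_triangle [n] (triangle n)"
proof (induction n)
  case 0
  show ?case unfolding r_triangle_def by (auto intro!: computes_PrimRec_0 computes_Zero)
next
  case (Suc n)
  have "computes (Comp r_add [Proj 0, Proj 1]) [n, triangle n] (n + triangle n)"
    by (rule computes_Comp2[OF _ _ computes_add]) (auto intro!: computes_ProjI)
  then have "computes (Comp Succ [Comp r_add [Proj 0, Proj 1]]) [n, triangle n] (triangle (Suc n))"
    by (auto simp: add.commute intro!: computes_Comp1 computes_Succ)
  then show ?case using Suc unfolding r_triangle_def by (rule computes_PrimRec_Suc[rotated])
qed

lemma computes_pair: "computes r_pair [m, n] (prod_encode (m, n))"
  unfolding r_pair_def prod_encode_def
  by (auto intro!: computes_Comp2[OF _ _ computes_add] computes_Comp1[OF computes_add computes_triangle]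
      computes_ProjI)

lemma computes_power2: "computes r_power2 [n] (2 ^ n)"
proof (induction n)
  case 0
  show ?case unfolding r_power2_def using computes_const[of 1] by (auto intro!: computes_PrimRec_0)
next
  case (Suc n)
  have "computes (Comp r_add [Proj 1, Proj 1]) [n, 2 ^ n] (2 ^ n + 2 ^ n)"
    by (rule computes_Comp2[OF _ _ computes_add]) (auto intro!: computes_ProjI)
  then show ?case using Suc unfolding r_power2_def
    by (auto intro!: computes_PrimRec_Suc simp: mult_2)
qed

lemma computes_cons:
  "computes f xs a \<Longrightarrow> computes g xs b \<Longrightarrow> computes (r_cons f g) xs (Suc (prod_encode (a, b)))"
  unfolding r_cons_def by (rule computes_Comp1[OF computes_Comp2[OF _ _ computes_pair] computes_Succ])

definition r_inverse_power2 :: "recf \<Rightarrow> recf" where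
  "r_inverse_power2 f = Comp r_pair [r_const 2, Comp r_power2 [Comp Succ [f]]]"

text \<open>The fraction is in lowest terms, and \<open>int_encode\<close> doubles nonnegative
  integers.\<close>

lemma encode_rat_inverse_power2: "encode_rat (1 / 2 ^ n) = prod_encode (2, 2 ^ Suc n)"
proof -
  have "quotient_of (1 / 2 ^ n) = (1, 2 ^ n)"
    using quotient_of_Fract[of 1 "2 ^ n"] by (simp add: Fract_of_int_quotient normalize_def)
  then show ?thesis by (simp add: encode_rat_def int_encode_def sum_encode_def nat_power_eq)
qed

lemma computes_inverse_power2:
  "computes f xs n \<Longrightarrow> computes (r_inverse_power2 f) xs (encode_rat (1 / 2 ^ n))"
  unfolding r_inverse_power2_def encode_rat_inverse_power2
  by (intro computes_Comp2[OF _ _ computes_pair] computes_const computes_Comp1[OF _ computes_power2]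
      computes_Comp1[OF _ computes_Succ])

text \<open>Each argument is used twice: as a part of the instance and as a counter value in the
  starting point. Argument 2, the code of the padding, is the tail of the list of start
  coordinates.\<close>

definition r_instance :: recf where
  "r_instance = r_cons (Proj 0) (r_cons (Proj 1)
     (r_cons (r_cons (r_inverse_power2 (Proj 0)) (r_cons (r_inverse_power2 (Proj 1))
               (r_cons (r_inverse_power2 (Proj 2)) (r_cons (r_inverse_power2 (Proj 3)) (Proj 2)))))
       (r_cons (Proj 3) Zero)))"

definition start_with :: "nat list \<Rightarrow> rat list \<Rightarrow> rat vec" where
  "start_with ws ps = vec_of_list (map (\<lambda>a. 1 / 2 ^ a) ws @ ps)"

lemma computes_instance:
  fixes ms :: "rat vec list" and ps :: "rat list" and \<phi> :: ltl
  defines "m \<equiv> list_encode (map (encode_vec encode_rat) ms)"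
    and "s \<equiv> list_encode (map encode_rat ps)" and "c \<equiv> encode_ltl \<phi>"
  shows "computes r_instance [d, m, s, c] (encode_instance (MC d ms (start_with [d, m, s, c] ps) \<phi>))"
proof -
  have enc: "encode_instance (MC d ms (start_with [d, m, s, c] ps) \<phi>) =
    list_encode [d, m, list_encode (encode_rat (1 / 2 ^ d) # encode_rat (1 / 2 ^ m)
      # encode_rat (1 / 2 ^ s) # encode_rat (1 / 2 ^ c) # map encode_rat ps), c]"
    by (simp add: encode_instance_def encode_vec_def start_with_def list_vec m_def c_def
        del: list_encode.simps)
  show ?thesis
    unfolding enc r_instance_def list_encode.simps
    by (intro computes_cons computes_inverse_power2 computes_Zero computes_ProjI)
      (simp_all add: s_def)
qed


section \<open>Undecidability\<close>

text \<open>The instances of a family differ only in four leading start coordinates, which can thus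
  be filled with the codes of what the family has in common. On that input
  \<open>Comp f [r_instance]\<close> gives the answer of \<open>f\<close> for the very instance
  whose truth contradicts this answer.\<close>

lemma diagonal:
  assumes "\<And>F. \<exists>d ms ps \<phi>. \<forall>ws. length ws = 4 \<longrightarrow>
      MC d ms (start_with ws ps) \<phi> \<in> I
      \<and> (computes F ws 0 \<longrightarrow> P (MC d ms (start_with ws ps) \<phi>))
      \<and> (computes F ws 1 \<longrightarrow> \<not> P (MC d ms (start_with ws ps) \<phi>))"
  shows "\<not> decidable_problem encode_instance I P"
proof
  assume "decidable_problem encode_instance I P"
  then obtain f where f: "\<And>i. i \<in> I \<Longrightarrow> computes f [encode_instance i] (if P i then 1 else 0)"
    unfolding decidable_problem_def by blast
  obtain d ms ps \<phi> where m: "\<And>ws. length ws = 4 \<Longrightarrow>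
      MC d ms (start_with ws ps) \<phi> \<in> I
      \<and> (computes (Comp f [r_instance]) ws 0 \<longrightarrow> P (MC d ms (start_with ws ps) \<phi>))
      \<and> (computes (Comp f [r_instance]) ws 1 \<longrightarrow> \<not> P (MC d ms (start_with ws ps) \<phi>))"
    using assms by metis
  define ws where "ws = [d, list_encode (map (encode_vec encode_rat) ms),
    list_encode (map encode_rat ps), encode_ltl \<phi>]"
  have "MC d ms (start_with ws ps) \<phi> \<in> I" using m[of ws] by (simp add: ws_def)
  from computes_Comp1[OF computes_instance[of d ms ps \<phi>, folded ws_def] f[OF this]] m[of ws]
  show False by (auto simp: ws_def split: if_splits)
qed

lemma simulation:
  obtains d ms ps \<phi> \<psi> where
    "\<And>ws. length ws = 4 \<Longrightarrow> MC d ms (start_with ws ps) \<phi> \<in> mc_instances {UOp}"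
    "\<And>ws. length ws = 4 \<Longrightarrow> MC d ms (start_with ws ps) \<psi> \<in> mc_instances {GOp, OrOp}"
    "\<And>ws. length ws = 4 \<Longrightarrow> computes F ws 0 \<Longrightarrow>
       mc_holds (MC d ms (start_with ws ps) \<phi>) \<and> \<not> mc_holds (MC d ms (start_with ws ps) \<psi>)"
    "\<And>ws y. length ws = 4 \<Longrightarrow> computes F ws (Suc y) \<Longrightarrow>
       \<not> mc_holds (MC d ms (start_with ws ps) \<phi>) \<and> mc_holds (MC d ms (start_with ws ps) \<psi>)"
proof -
  obtain prog where prog:
    "\<And>v. computes F (map v [0..<4]) 0 \<Longrightarrow> halts_on prog v"
    "\<And>v y. computes F (map v [0..<4]) (Suc y) \<Longrightarrow> \<not> halts_on prog v"
    using halting_program[of F 4] by blast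
  \<comment> \<open>Four registers are reserved for the input, even if the program mentions
    fewer.\<close>
  obtain K B where KB: "machine prog K B" "4 \<le> K" by (rule machine_exists[where m = 4])
  interpret machine prog K B by (rule KB(1))
  define input where "input ws = (\<lambda>r. if r < length ws then ws ! r else 0)" for ws :: "nat list"
  define inst where "inst ws = MC (2 * k + period) rat_modes (start_with ws (padding 4))" for ws
  have inst: "mode_set (inst ws \<phi>) = Modes" "dimension (inst ws \<phi>) = 2 * k + period"
    "formula (inst ws \<phi>) = \<phi>" for ws \<phi>
    by (simp_all add: inst_def mode_set_def Modes_def)
  have init: "initial (start_data (input ws)) (start_point (inst ws \<phi>))" if "length ws = 4" for ws \<phi>
    using initial_padding[of ws] KB(2) that
    by (simp add: input_def inst_def start_point_def start_with_def)
  have input: "map (input ws) [0..<4] = ws" if "length ws = 4" for ws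
    using that by (intro nth_equalityI) (simp_all add: input_def)
  have member: "inst ws \<phi> \<in> mc_instances X" if "length ws = 4" "\<phi> \<in> LTL\<^sub>B (2 * k + period) X" for ws \<phi> X
    using init[OF that(1), of \<phi>] that(2) mms_Modes by (simp add: mc_instances_def inst initial_def)
  have holds: "mc_holds (inst ws reach_formula) \<longleftrightarrow> halts_on prog (input ws)"
    "mc_holds (inst ws safe_formula) \<longleftrightarrow> \<not> halts_on prog (input ws)" if "length ws = 4" for ws
    unfolding mc_holds_def inst
    by (rule reach_iff_halts[OF init[OF that]], rule safe_iff_not_halts[OF init[OF that]])
  show thesis
  proof (rule that[of "2 * k + period" rat_modes "padding 4" reach_formula safe_formula, folded inst_def])
    fix ws :: "nat list" assume ws: "length ws = 4"
    show "inst ws reach_formula \<in> mc_instances {UOp}"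
      "inst ws safe_formula \<in> mc_instances {GOp, OrOp}"
      using member[OF ws] reach_formula_fragment safe_formula_fragment by blast+
    show "mc_holds (inst ws reach_formula) \<and> \<not> mc_holds (inst ws safe_formula)"
      if "computes F ws 0"
      using prog(1)[of "input ws"] that holds[OF ws] by (simp add: input[OF ws])
    show "\<not> mc_holds (inst ws reach_formula) \<and> mc_holds (inst ws safe_formula)"
      if "computes F ws (Suc y)" for y
      using prog(2)[of "input ws"] that holds[OF ws] by (simp add: input[OF ws])
  qed
qed

text \<open>\<open>diagonal\<close> wants truth where \<open>F\<close> has the value 0, but the
  safety formula is true where the simulated function has a positive value; hence the answer is
  flipped before it is simulated.\<close>

definition r_not :: recf where
  "r_not = PrimRec (r_const 1) Zero"

lemma computes_not: "computes r_not [0] 1" "computes r_not [1] 0"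
  using computes_const[of 1]
  by (auto simp: r_not_def intro!: computes_PrimRec_0 computes_PrimRec_Suc[OF computes_PrimRec_0] computes_Zero)

theorem theorem7:
  shows "\<not> decidable_problem encode_instance (mc_instances {UOp}) mc_holds
       \<and> \<not> decidable_problem encode_instance (mc_instances {GOp, OrOp}) mc_holds"
proof
  show "\<not> decidable_problem encode_instance (mc_instances {UOp}) mc_holds"
  proof (rule diagonal)
    fix F
    show "\<exists>d ms ps \<phi>. \<forall>ws. length ws = 4 \<longrightarrow>
        MC d ms (start_with ws ps) \<phi> \<in> mc_instances {UOp}
        \<and> (computes F ws 0 \<longrightarrow> mc_holds (MC d ms (start_with ws ps) \<phi>))
        \<and> (computes F ws 1 \<longrightarrow> \<not> mc_holds (MC d ms (start_with ws ps) \<phi>))"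
      by (rule simulation[of F]) (metis One_nat_def)
  qed
  show "\<not> decidable_problem encode_instance (mc_instances {GOp, OrOp}) mc_holds"
  proof (rule diagonal)
    fix F
    have neg: "computes F ws 0 \<Longrightarrow> computes (Comp r_not [F]) ws (Suc 0)"
      "computes F ws 1 \<Longrightarrow> computes (Comp r_not [F]) ws 0" for ws
      using computes_Comp1 computes_not by (metis One_nat_def)+
    show "\<exists>d ms ps \<phi>. \<forall>ws. length ws = 4 \<longrightarrow>
        MC d ms (start_with ws ps) \<phi> \<in> mc_instances {GOp, OrOp}
        \<and> (computes F ws 0 \<longrightarrow> mc_holds (MC d ms (start_with ws ps) \<phi>))
        \<and> (computes F ws 1 \<longrightarrow> \<not> mc_holds (MC d ms (start_with ws ps) \<phi>))"
      by (rule simulation[of "Comp r_not [F]"]) (metis neg)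
  qed
qed

end
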